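(* Let $X\subset\mathbb R^d$ be compact and convex, and let $k$ be the Gaussian kernel with $k(\cdot,\cdot)\le1$. Let $(\boldsymbol\tau_i)_{i\ge1}$ be trajectories in $X^m$ produced by the determinant-based exploration scheme without safety considerations, i.e. for every $i$, $\boldsymbol\tau_i=\boldsymbol\tau_i(\boldsymbol\eta_i)$ with $$\boldsymbol\eta_i\in\operatorname{argmax}_{\boldsymbol\eta\in\Pi}\ \det\boldsymbol\Sigma_{i-1}(\boldsymbol\tau_i(\boldsymbol\eta)),$$ where $\boldsymbol\Sigma_{i-1}$ is the GP predictive covariance given $\boldsymbol\tau_1,\dots,\boldsymbol\tau_{i-1}$. Let $(\tilde{\boldsymbol\tau}_i)_{i\ge1}$ be trajectories within $X$ such that each $\tilde{\boldsymbol\tau}_i$ shares the same start point with $\boldsymbol\tau_i$, i.e. $\tilde{\boldsymbol\tau}_i=\boldsymbol\tau_i(\tilde{\boldsymbol\eta}_i)$ for some $\tilde{\boldsymbol\eta}_i\in\Pi$. Then, as $n\to\infty$, $$\frac1n\sum_{i=1}^n\left|\boldsymbol\Sigma_{i-1}(\tilde{\boldsymbol\tau}_i)\right|=\mathcal O\left(\frac{\log(n)^{d+1}}{n}\right),$$ where $|\cdot|$ denotes the determinant.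
   Context: Setting: $X\subset\mathbb R^d$ is the input space, and $m\ge1$ is a fixed integer. A trajectory is an $m$-tuple $\boldsymbol\tau=(\boldsymbol x_1,\dots,\boldsymbol x_m)\in X^m$. The kernel is $k(\boldsymbol x,\boldsymbol x')=\sigma_f^2\exp(-\tfrac12(\boldsymbol x-\boldsymbol x')^T\boldsymbol\Lambda_f^2(\boldsymbol x-\boldsymbol x'))$ with fixed $\sigma_f^2>0$ and fixed symmetric positive definite $\boldsymbol\Lambda_f^2$; the noise variance is a fixed $\sigma^2>0$. Parametrization: at step $i$ the candidate trajectories form a family $\{\boldsymbol\tau_i(\boldsymbol\eta):\boldsymbol\eta\in\Pi\}\subset X^m$, where $\Pi$ is the domain of the manipulated variable and the map $\boldsymbol\eta\mapsto\boldsymbol\tau_i(\boldsymbol\eta)$ is determined by the start point (the end point of the previous trajectory $\boldsymbol\tau_{i-1}$) and the already executed trajectories. Example (ramps): inputs have the form $\boldsymbol x_k=(\boldsymbol u_k,\dots,\boldsymbol u_{k-d_2+1})$ with $\boldsymbol u_k\in\mathbb R^{d_1}$, $d=d_1d_2$, and on a ramp with start point $\boldsymbol u_0$ and end point $\boldsymbol\eta$, $\boldsymbol u_k=\boldsymbol u_0+\frac km(\boldsymbol\eta-\boldsymbol u_0)$ for $0\le k\le m$, while $\boldsymbol u_k$ for $k<0$ is read off from previously executed trajectories. The maxima in the exploration scheme are assumed attained. Predictive covariance: for $i\ge1$, with $\boldsymbol T_{i-1}$ the list of all $(i-1)m$ input points of $\boldsymbol\tau_1,\dots,\boldsymbol\tau_{i-1}$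 and $\boldsymbol K_{i-1}$ its kernel matrix, $$\boldsymbol\Sigma_{i-1}(\boldsymbol\tau)=\boldsymbol k(\boldsymbol\tau,\boldsymbol\tau)-\boldsymbol k(\boldsymbol T_{i-1},\boldsymbol\tau)^T(\boldsymbol K_{i-1}+\sigma^2\boldsymbol I)^{-1}\boldsymbol k(\boldsymbol T_{i-1},\boldsymbol\tau)\in\mathbb R^{m\times m},\qquad \boldsymbol\Sigma_0(\boldsymbol\tau)=\boldsymbol k(\boldsymbol\tau,\boldsymbol\tau),$$ where $\boldsymbol k(\cdot,\cdot)$ denotes matrices of kernel evaluations. *)

theory Defs
  imports
    "HOL-Analysis.Analysis"
    "HOL-Library.Landau_Symbols"
    "Jordan_Normal_Form.Gauss_Jordan_Elimination"
    "Jordan_Normal_Form.Determinant"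
begin

text \<open>
  Two matrix libraries are in use. The length-scale matrix lives in the fixed ambient space and is
  of type \<open>real^'d^'d\<close>; kernel and covariance matrices, whose size grows with the number of
  executed trajectories, have type \<open>real mat\<close>. Names occurring in both are qualified.
\<close>

definition sym_pos_def :: "real^'d^'d \<Rightarrow> bool" where
  "sym_pos_def A \<longleftrightarrow>
     Finite_Cartesian_Product.transpose A = A \<and> (\<forall>v. v \<noteq> 0 \<longrightarrow> inner v (A *v v) > 0)"

text \<open>The arguments \<open>sf2\<close> and \<open>L2\<close> stand for $\sigma_f^2$ and $\Lambda_f^2$ (already squared).\<close>

definition gauss_kernel :: "real \<Rightarrow> real^'d^'d \<Rightarrow> real^'d \<Rightarrow> real^'d \<Rightarrow> real" where
  "gauss_kernel sf2 L2 x x' = sf2 * exp (- (1/2) * inner (x - x') (L2 *v (x - x')))"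

definition kernel_mat :: "('a \<Rightarrow> 'a \<Rightarrow> real) \<Rightarrow> 'a list \<Rightarrow> 'a list \<Rightarrow> real mat" where
  "kernel_mat k xs ys = Matrix.mat (length xs) (length ys) (\<lambda>(a, b). k (xs ! a) (ys ! b))"

text \<open>
  Predictive covariance at the list of points \<open>t\<close> given observations with noise variance \<open>s2\<close> at
  the list of points \<open>T\<close>. For \<open>s2 > 0\<close> and a positive semidefinite kernel \<open>k\<close>, the matrix inside
  \<open>mat_inverse\<close> is invertible, so \<open>the\<close> selects its inverse.
\<close>

definition pred_cov :: "('a \<Rightarrow> 'a \<Rightarrow> real) \<Rightarrow> real \<Rightarrow> 'a list \<Rightarrow> 'a list \<Rightarrow> real mat" where
  "pred_cov k s2 T t =
     (if T = [] then kernel_mat k t t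
      else kernel_mat k t t
             - transpose_mat (kernel_mat k T t)
               * the (mat_inverse (kernel_mat k T T + s2 \<cdot>\<^sub>m 1\<^sub>m (length T)))
               * kernel_mat k T t)"

text \<open>
  Trajectories are lists of input points, numbered from 1. The list \<open>executed \<tau> i\<close> consists of the
  trajectories 1 to \<open>i - 1\<close>, that is, those available when the trajectory number \<open>i\<close> is planned.
\<close>

definition executed :: "(nat \<Rightarrow> 'a list) \<Rightarrow> nat \<Rightarrow> 'a list list" where
  "executed \<tau> i = map \<tau> [1..<i]"

text \<open>The covariance $\Sigma_{i-1}$ is \<open>step_cov k s2 \<tau> i\<close>: the index is that of the planned trajectory.\<close>

definition step_cov ::
    "('a \<Rightarrow> 'a \<Rightarrow> real) \<Rightarrow> real \<Rightarrow> (nat \<Rightarrow> 'a list) \<Rightarrow> nat \<Rightarrow> 'a list \<Rightarrow> real mat" where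
  "step_cov k s2 \<tau> i t = pred_cov k s2 (concat (executed \<tau> i)) t"

text \<open>
  The start point is the end point of the previous trajectory; the very first trajectory starts
  at a given point \<open>x0\<close>.
\<close>

definition start_point :: "'a \<Rightarrow> (nat \<Rightarrow> 'a list) \<Rightarrow> nat \<Rightarrow> 'a" where
  "start_point x0 \<tau> i = (if i \<le> 1 then x0 else last (\<tau> (i - 1)))"

text \<open>
  The candidate trajectory $\tau_i(\eta)$. The parametrization \<open>\<phi>\<close> takes the start point, the
  executed trajectories and the manipulated variable; whatever else it needs before the first
  step (such as earlier values of the inputs) is part of \<open>\<phi>\<close>.
\<close>

definition candidate ::
    "('a \<Rightarrow> 'a list list \<Rightarrow> 'p \<Rightarrow> 'a list) \<Rightarrow> 'a \<Rightarrow> (nat \<Rightarrow> 'a list) \<Rightarrow> nat \<Rightarrow> 'p \<Rightarrow> 'a list" where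
  "candidate \<phi> x0 \<tau> i \<eta> = \<phi> (start_point x0 \<tau> i) (executed \<tau> i) \<eta>"

end

theory Submission
  imports Defs "HOL-Real_Asymp.Real_Asymp"
begin

text \<open>
  By Hadamard's inequality the determinant of a predictive covariance is at most a constant times
  the predictive variance at the first point of the trajectory, and the maximising trajectory
  dominates every competitor, so it suffices to bound the sum of the variances of the successive
  points given all earlier ones. The predictive variance is the minimum over \<open>\<alpha>\<close> of a quadratic
  functional that is linear in the kernel, hence an entrywise \<open>\<epsilon>\<close>-approximation of the kernel by
  a Gram matrix of \<open>D\<close> features changes it only by \<open>O(N \<epsilon>)\<close>. For \<open>D\<close> features the variances
  are the factors in the determinants of successive rank-one updates, and Hadamard's inequality
  bounds their sum by \<open>O(D log N)\<close>. Writing the quadratic form of the Gaussian kernel as a sum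
  of \<open>d\<close> squares and truncating each of the \<open>d\<close> exponential series after \<open>q\<close> terms gives
  \<open>D = q^d\<close> and \<open>\<epsilon> = O(exp (- 2 q))\<close>; take \<open>q\<close> to be about \<open>log n\<close>.
\<close>

section \<open>Determinants of positive semidefinite matrices\<close>

text \<open>Block elimination of the first column: \<open>?L\<close> is unit lower triangular and
  \<open>?U\<close> is block upper triangular, so the determinant can be read off the factors. It
  serves both Hadamard's inequality and the rank-one update formula.\<close>

lemma det_schur_complement:
  fixes a :: "'a::field"
  assumes B: "B \<in> carrier_mat 1 n" and C: "C \<in> carrier_mat n 1" and D: "D \<in> carrier_mat n n"
    and a: "a \<noteq> 0"
  shows "Determinant.det (four_block_mat (Matrix.mat 1 1 (\<lambda>_. a)) B C D)
    = a * Determinant.det (D - inverse a \<cdot>\<^sub>m (C * B))"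
proof -
  let ?a = "Matrix.mat 1 1 (\<lambda>_. a)"
  let ?L = "four_block_mat (1\<^sub>m 1) (0\<^sub>m 1 n) (inverse a \<cdot>\<^sub>m C) (1\<^sub>m n)"
  let ?U = "four_block_mat ?a B (0\<^sub>m n 1) (D - inverse a \<cdot>\<^sub>m (C * B))"
  have a1: "?a \<in> carrier_mat 1 1" by simp
  have "?L * ?U = four_block_mat (1\<^sub>m 1 * ?a + 0\<^sub>m 1 n * 0\<^sub>m n 1)
      (1\<^sub>m 1 * B + 0\<^sub>m 1 n * (D - inverse a \<cdot>\<^sub>m (C * B)))
      ((inverse a \<cdot>\<^sub>m C) * ?a + 1\<^sub>m n * 0\<^sub>m n 1)
      ((inverse a \<cdot>\<^sub>m C) * B + 1\<^sub>m n * (D - inverse a \<cdot>\<^sub>m (C * B)))"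
    by (rule mult_four_block_mat) (use B C D in auto)
  also have "\<dots> = four_block_mat ?a B C D"
  proof -
    have 1: "1\<^sub>m 1 * ?a + 0\<^sub>m 1 n * 0\<^sub>m n 1 = ?a" by simp
    have 2: "1\<^sub>m 1 * B + 0\<^sub>m 1 n * (D - inverse a \<cdot>\<^sub>m (C * B)) = B"
      using B C D by auto
    have 3: "(inverse a \<cdot>\<^sub>m C) * ?a + 1\<^sub>m n * 0\<^sub>m n 1 = C"
      using C a by (intro eq_matI) (auto simp: scalar_prod_def)
    have 4: "(inverse a \<cdot>\<^sub>m C) * B + 1\<^sub>m n * (D - inverse a \<cdot>\<^sub>m (C * B)) = D"
      using B C D by (intro eq_matI) auto
    show ?thesis unfolding 1 2 3 4 ..
  qed
  finally have *: "four_block_mat ?a B C D = ?L * ?U" ..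
  have dL: "Determinant.det ?L = 1"
    by (subst det_four_block_mat_upper_right_zero) (use C in auto)
  have dU: "Determinant.det ?U = a * Determinant.det (D - inverse a \<cdot>\<^sub>m (C * B))"
    by (subst det_four_block_mat_lower_left_zero_col) (use B C D in \<open>auto simp: det_single\<close>)
  have "Determinant.det (?L * ?U) = Determinant.det ?L * Determinant.det ?U"
    by (rule det_mult[where n = "1 + n"]) (use B C D in auto)
  then show ?thesis unfolding * dL dU by simp
qed

text \<open>Test vectors are functions on indices, so that forms become plain double sums and
  vectors can be extended or combined by ordinary sum lemmas. Symmetry is stated separately because
  a real quadratic form does not see the antisymmetric part.\<close>

definition psd_mat :: "nat \<Rightarrow> real mat \<Rightarrow> bool" where
  "psd_mat n A \<longleftrightarrow> A \<in> carrier_mat n n \<and> (\<forall>i<n. \<forall>j<n. A $$ (i, j) = A $$ (j, i)) \<and>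
     (\<forall>u. 0 \<le> (\<Sum>i<n. \<Sum>j<n. u i * u j * A $$ (i, j)))"

lemma sum_mult_delta [simp]:
  fixes f :: "'b \<Rightarrow> 'a::semiring_1"
  assumes "finite A" "a \<in> A"
  shows "(\<Sum>i\<in>A. (if i = a then c else 0) * f i) = c * f a"
proof -
  have "(\<Sum>i\<in>A. (if i = a then c else 0) * f i) = (\<Sum>i\<in>A. if i = a then c * f i else 0)"
    by (rule sum.cong) auto
  then show ?thesis using assms by simp
qed

lemma psd_mat_diag_nonneg:
  assumes "psd_mat n A" "a < n"
  shows "0 \<le> A $$ (a, a)"
proof -
  have "0 \<le> (\<Sum>i<n. \<Sum>j<n. (if i = a then 1 else 0) * (if j = a then 1 else 0) * A $$ (i, j))"
    using assms(1) unfolding psd_mat_def by meson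
  then show ?thesis using assms(2) by (simp add: mult.assoc flip: sum_distrib_left)
qed

text \<open>On the line t e_a + e_b the quadratic form is affine in t once the (a, a) entry
  vanishes. A nonnegative affine function is constant, so its slope, twice the (a, b) entry, is
  zero.\<close>

lemma psd_mat_zero_diag:
  assumes A: "psd_mat n A" and ab: "a < n" "b < n" and z: "A $$ (a, a) = 0"
  shows "A $$ (a, b) = 0"
proof (cases "a = b")
  case False
  have sym: "A $$ (b, a) = A $$ (a, b)" using A ab unfolding psd_mat_def by blast
  have "0 \<le> 2 * t * A $$ (a, b) + A $$ (b, b)" for t
  proof -
    let ?u = "\<lambda>i. (if i = a then t else 0) + (if i = b then 1 else 0)"
    have "0 \<le> (\<Sum>i<n. \<Sum>j<n. ?u i * ?u j * A $$ (i, j))"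
      using A unfolding psd_mat_def by (elim conjE allE)
    also have "\<dots> = (\<Sum>i<n. ?u i * (\<Sum>j<n. ?u j * A $$ (i, j)))"
      by (simp add: sum_distrib_left mult.assoc)
    also have "\<dots> = 2 * t * A $$ (a, b) + A $$ (b, b)"
      using ab z sym by (simp add: distrib_right sum.distrib)
    finally show ?thesis .
  qed
  \<comment> \<open>With a nonzero slope, this t would give the affine function the value
    -1.\<close>
  from this[of "- (A $$ (b, b) + 1) / (2 * A $$ (a, b))"] show ?thesis
    by (cases "A $$ (a, b) = 0") (auto simp: field_simps)
qed (use z in simp)

text \<open>Hadamard's inequality by induction on the size. A zero pivot kills the whole first row
  and hence the determinant. Otherwise the Schur complement S of the pivot is again positive
  semidefinite, and its diagonal is that of the remaining block minus squares divided by the pivot,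
  hence no larger.\<close>

lemma psd_mat_det:
  assumes "psd_mat n A"
  shows "0 \<le> Determinant.det A" "Determinant.det A \<le> (\<Prod>i<n. A $$ (i, i))"
proof -
  have "0 \<le> Determinant.det A \<and> Determinant.det A \<le> (\<Prod>i<n. A $$ (i, i))"
    using assms
  proof (induction n arbitrary: A)
    case 0
    then show ?case by (auto simp: psd_mat_def)
  next
    case (Suc n)
    have carr: "A \<in> carrier_mat (Suc n) (Suc n)" using Suc.prems by (simp add: psd_mat_def)
    have sym: "A $$ (i, j) = A $$ (j, i)" if "i < Suc n" "j < Suc n" for i j
      using Suc.prems that unfolding psd_mat_def by blast
    define a where "a = A $$ (0, 0)"
    have a0: "a \<ge> 0" unfolding a_def by (rule psd_mat_diag_nonneg[OF Suc.prems]) simp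
    have d0: "A $$ (i, i) \<ge> 0" if "i < Suc n" for i
      by (rule psd_mat_diag_nonneg[OF Suc.prems that])
    show ?case
    proof (cases "a = 0")
      case True
      have z: "A $$ (0, j) = 0" if "j < Suc n" for j
        using psd_mat_zero_diag[OF Suc.prems _ that, of 0] True by (simp add: a_def)
      have "Determinant.det A = (\<Sum>j<Suc n. A $$ (0, j) * cofactor A 0 j)"
        by (rule laplace_expansion_row[OF carr]) simp
      also have "\<dots> = 0" using z by (intro sum.neutral) auto
      finally show ?thesis using d0 by (auto intro!: prod_nonneg simp del: prod.lessThan_Suc)
    next
      case False
      then have apos: "a > 0" using a0 by simp
      define B where "B = Matrix.mat 1 n (\<lambda>(i, j). A $$ (0, Suc j))"
      define C where "C = Matrix.mat n 1 (\<lambda>(i, j). A $$ (Suc i, 0))"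
      define D where "D = Matrix.mat n n (\<lambda>(i, j). A $$ (Suc i, Suc j))"
      define S where "S = D - inverse a \<cdot>\<^sub>m (C * B)"
      have Sc: "S \<in> carrier_mat n n" by (auto simp: S_def D_def B_def C_def)
      have Sij: "S $$ (i, j) = A $$ (Suc i, Suc j) - A $$ (0, Suc i) * A $$ (0, Suc j) / a"
        if "i < n" "j < n" for i j
        using that sym[of "Suc i" 0]
        by (simp add: S_def B_def C_def D_def scalar_prod_def divide_inverse mult_ac)
      have "A = four_block_mat (Matrix.mat 1 1 (\<lambda>_. a)) B C D"
        using carr by (intro eq_matI) (auto simp: a_def B_def C_def D_def)
      also have "Determinant.det \<dots> = a * Determinant.det S"
        unfolding S_def using False
        by (intro det_schur_complement[where n = n]) (simp_all add: B_def C_def D_def)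
      finally have det: "Determinant.det A = a * Determinant.det S" .
      have psdS: "psd_mat n S" unfolding psd_mat_def
      proof (intro conjI allI impI)
        show "S \<in> carrier_mat n n" by (rule Sc)
        show "S $$ (i, j) = S $$ (j, i)" if "i < n" "j < n" for i j
          using that sym[of "Suc i" "Suc j"] by (simp add: Sij)
        fix u :: "nat \<Rightarrow> real"
        define g where "g = (\<Sum>j<n. u j * A $$ (0, Suc j))"
        \<comment> \<open>The first coordinate is the one minimising the form of A over all
          extensions of u. It makes row 0 of the form vanish, and what remains is exactly the form
          of S at u.\<close>
        define w where "w i = (case i of 0 \<Rightarrow> - g / a | Suc i \<Rightarrow> u i)" for i
        have "0 \<le> (\<Sum>i<Suc n. \<Sum>j<Suc n. w i * w j * A $$ (i, j))"
          using Suc.prems unfolding psd_mat_def by (elim conjE allE)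
        also have "\<dots> = (\<Sum>i<Suc n. w i * (\<Sum>j<Suc n. w j * A $$ (i, j)))"
          by (simp add: sum_distrib_left mult.assoc del: sum.lessThan_Suc)
        also have "\<dots> = w 0 * (\<Sum>j<Suc n. w j * A $$ (0, j))
            + (\<Sum>i<n. u i * (\<Sum>j<Suc n. w j * A $$ (Suc i, j)))"
          by (subst sum.lessThan_Suc_shift) (simp add: w_def)
        also have "(\<Sum>j<Suc n. w j * A $$ (0, j)) = 0"
          unfolding sum.lessThan_Suc_shift by (simp add: w_def g_def False flip: a_def)
        also have "(\<Sum>i<n. u i * (\<Sum>j<Suc n. w j * A $$ (Suc i, j)))
            = (\<Sum>i<n. u i * (\<Sum>j<n. u j * S $$ (i, j)))"
        proof (rule sum.cong[OF refl])
          fix i assume "i \<in> {..<n}"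
          then have i: "i < n" by simp
          have "(\<Sum>j<Suc n. w j * A $$ (Suc i, j))
              = - g / a * A $$ (0, Suc i) + (\<Sum>j<n. u j * A $$ (Suc i, Suc j))"
            unfolding sum.lessThan_Suc_shift using sym[of "Suc i" 0] i by (simp add: w_def)
          also have "\<dots> = (\<Sum>j<n. u j * S $$ (i, j))"
            using i by (simp add: Sij g_def right_diff_distrib sum_subtractf sum_distrib_left
                sum_divide_distrib mult_ac)
          finally show "u i * (\<Sum>j<Suc n. w j * A $$ (Suc i, j))
              = u i * (\<Sum>j<n. u j * S $$ (i, j))" by simp
        qed
        finally show "0 \<le> (\<Sum>i<n. \<Sum>j<n. u i * u j * S $$ (i, j))"
          by (simp add: sum_distrib_left mult.assoc)
      qed
      note IH = Suc.IH[OF psdS] and Sd = psd_mat_diag_nonneg[OF psdS]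
      have "(\<Prod>i<n. S $$ (i, i)) \<le> (\<Prod>i<n. A $$ (Suc i, Suc i))"
      proof (rule prod_mono)
        fix i assume "i \<in> {..<n}"
        then have i: "i < n" by simp
        show "0 \<le> S $$ (i, i) \<and> S $$ (i, i) \<le> A $$ (Suc i, Suc i)"
          using Sd[OF i] apos Sij[OF i i] by simp
      qed
      then have "a * Determinant.det S \<le> a * (\<Prod>i<n. A $$ (Suc i, Suc i))"
        using a0 IH by (intro mult_left_mono) (auto intro: order_trans)
      moreover have "(\<Prod>i<Suc n. A $$ (i, i)) = a * (\<Prod>i<n. A $$ (Suc i, Suc i))"
        unfolding prod.lessThan_Suc_shift by (simp add: a_def)
      ultimately show ?thesis
        using det a0 IH by auto
    qed
  qed
  then show "0 \<le> Determinant.det A" "Determinant.det A \<le> (\<Prod>i<n. A $$ (i, i))" by auto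
qed

section \<open>Rank-one updates and the elliptical potential\<close>

text \<open>The bordered matrix \<open>?B\<close> is evaluated twice: eliminating its scalar block
  leaves A + f f^T, while column operations with \<open>?W\<close> clear f and leave a triangular
  matrix with 1 + f^T w in the corner. Asking for a solution w of A w = f keeps inverses out of the
  formula.\<close>

lemma det_rank_one_update:
  fixes A :: "'a::field mat"
  assumes A: "A \<in> carrier_mat n n" and f: "f \<in> carrier_mat n 1" and w: "w \<in> carrier_mat n 1"
    and Aw: "A * w = f"
  shows "Determinant.det (A + f * transpose_mat f)
    = Determinant.det A * (1 + (transpose_mat f * w) $$ (0, 0))"
proof -
  let ?one = "Matrix.mat 1 1 (\<lambda>_. 1 :: 'a)"
  let ?F = "- transpose_mat f"
  let ?B = "four_block_mat ?one ?F f A"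
  let ?W = "four_block_mat ?one (0\<^sub>m 1 n) (- w) (1\<^sub>m n)"
  let ?U = "four_block_mat (?one + transpose_mat f * w) ?F (0\<^sub>m n 1) A"
  have one: "?one = 1\<^sub>m 1" by (intro eq_matI) auto
  have "Determinant.det ?B = 1 * Determinant.det (A - inverse 1 \<cdot>\<^sub>m (f * ?F))"
    by (rule det_schur_complement) (use A f in auto)
  also have "A - inverse 1 \<cdot>\<^sub>m (f * ?F) = A + f * transpose_mat f"
    using A f by (intro eq_matI) auto
  finally have 1: "Determinant.det ?B = Determinant.det (A + f * transpose_mat f)" by simp
  have "?B * ?W = four_block_mat (?one * ?one + ?F * - w) (?one * 0\<^sub>m 1 n + ?F * 1\<^sub>m n)
      (f * ?one + A * - w) (f * 0\<^sub>m 1 n + A * 1\<^sub>m n)"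
    by (rule mult_four_block_mat) (use A f w in auto)
  also have "\<dots> = ?U"
  proof -
    have "?one * ?one + ?F * - w = ?one + transpose_mat f * w"
      using f w unfolding one by (intro eq_matI) auto
    moreover have "?one * 0\<^sub>m 1 n + ?F * 1\<^sub>m n = ?F" using f by (intro eq_matI) auto
    moreover have "f * ?one + A * - w = 0\<^sub>m n 1"
      unfolding one Aw[symmetric] using A w by (intro eq_matI) auto
    moreover have "f * 0\<^sub>m 1 n + A * 1\<^sub>m n = A" using f A by (intro eq_matI) auto
    ultimately show ?thesis by simp
  qed
  finally have 2: "?B * ?W = ?U" .
  have "Determinant.det ?W = 1"
    by (subst det_four_block_mat_upper_right_zero) (use w in \<open>auto simp: det_single\<close>)
  moreover have "Determinant.det (?B * ?W) = Determinant.det ?B * Determinant.det ?W"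
    by (rule det_mult[where n = "1 + n"]) (use A f w in auto)
  moreover have "Determinant.det ?U
      = Determinant.det (?one + transpose_mat f * w) * Determinant.det A"
    by (rule det_four_block_mat_lower_left_zero_col) (use A f w in auto)
  moreover have "Determinant.det (?one + transpose_mat f * w) = 1 + (transpose_mat f * w) $$ (0, 0)"
    using f w by (subst det_single) auto
  ultimately show ?thesis using 1 2 by (simp add: mult.commute)
qed

lemma quadratic_form_add_diag:
  fixes u :: "nat \<Rightarrow> real"
  shows "(\<Sum>i<n. \<Sum>j<n. u i * u j * ((if i = j then s else 0) + K i j))
    = s * (\<Sum>i<n. (u i)\<^sup>2) + (\<Sum>i<n. \<Sum>j<n. u i * u j * K i j)"
proof -
  have "(\<Sum>j<n. u i * u j * (if i = j then s else 0)) = s * (u i)\<^sup>2" if "i < n" for i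
  proof -
    have "(\<Sum>j<n. u i * u j * (if i = j then s else 0)) = (\<Sum>j<n. if i = j then u i * u j * s else 0)"
      by (rule sum.cong) auto
    then show ?thesis using that by (simp add: power2_eq_square mult_ac)
  qed
  then show ?thesis
    by (simp add: distrib_left sum.distrib sum_distrib_left)
qed

lemma quadratic_form_gram:
  fixes u :: "nat \<Rightarrow> real"
  shows "(\<Sum>c<D. \<Sum>d<D. u c * u d * (\<Sum>l<j. \<phi> l c * \<phi> l d))
    = (\<Sum>l<j. (\<Sum>c<D. u c * \<phi> l c)\<^sup>2)"
proof -
  have "(\<Sum>l<j. (\<Sum>c<D. u c * \<phi> l c)\<^sup>2)
      = (\<Sum>l<j. \<Sum>c<D. \<Sum>d<D. u c * u d * (\<phi> l c * \<phi> l d))"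
    by (simp add: power2_eq_square sum_product mult_ac)
  also have "\<dots> = (\<Sum>c<D. \<Sum>l<j. \<Sum>d<D. u c * u d * (\<phi> l c * \<phi> l d))"
    by (rule sum.swap)
  also have "\<dots> = (\<Sum>c<D. \<Sum>d<D. \<Sum>l<j. u c * u d * (\<phi> l c * \<phi> l d))"
    by (intro sum.cong refl sum.swap)
  finally show ?thesis by (simp add: sum_distrib_left)
qed

text \<open>A null vector would have zero quadratic form, which coercivity permits only for the zero
  vector. Besides solvability this ensures that \<open>mat_inverse\<close> returns
  \<open>Some\<close>, which gives meaning to the \<open>the\<close> in
  \<open>pred_cov\<close>.\<close>

lemma coercive_mat_inverse:
  fixes A :: "real mat"
  assumes A: "A \<in> carrier_mat n n" and s: "s > 0"
    and coercive: "\<And>u. s * (\<Sum>i<n. (u i)\<^sup>2) \<le> (\<Sum>i<n. \<Sum>j<n. u i * u j * A $$ (i, j))"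
  obtains B where "mat_inverse A = Some B" "B \<in> carrier_mat n n" "A * B = 1\<^sub>m n"
proof -
  have "Determinant.det A \<noteq> 0"
  proof
    assume "Determinant.det A = 0"
    then obtain v where v: "v \<in> carrier_vec n" "v \<noteq> 0\<^sub>v n" "A *\<^sub>v v = 0\<^sub>v n"
      using det_0_iff_vec_prod_zero[OF A] by blast
    define u where "u i = vec_index v i" for i
    have "(\<Sum>j<n. u j * A $$ (i, j)) = 0" if "i < n" for i
    proof -
      have "vec_index (A *\<^sub>v v) i = 0" using v(3) that by simp
      then show ?thesis
        using that A v(1) by (simp add: u_def scalar_prod_def lessThan_atLeast0 mult.commute)
    qed
    then have "(\<Sum>i<n. u i * (\<Sum>j<n. u j * A $$ (i, j))) = 0" by simp
    then have "s * (\<Sum>i<n. (u i)\<^sup>2) \<le> 0"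
      using coercive[of u] by (simp add: sum_distrib_left mult.assoc)
    moreover have "(\<Sum>i<n. (u i)\<^sup>2) \<ge> 0" by (simp add: sum_nonneg)
    ultimately have "(\<Sum>i<n. (u i)\<^sup>2) = 0" using s by (simp add: mult_le_0_iff)
    then have "\<forall>i<n. u i = 0" by (simp add: sum_nonneg_eq_0_iff)
    then have "v = 0\<^sub>v n" using v(1) by (intro eq_vecI) (auto simp: u_def)
    with v(2) show False ..
  qed
  then have "A \<in> Units (ring_mat TYPE(real) n ())" by (rule det_non_zero_imp_unit[OF A])
  with mat_inverse(1)[OF A, where b = "()"] obtain B where B: "mat_inverse A = Some B"
    by (cases "mat_inverse A") auto
  show ?thesis by (rule that[OF B]) (use mat_inverse(2)[OF A B] in auto)
qed

text \<open>The vector \<open>w j\<close> is $A_j^{-1} \phi_j$ for $A_j = s I + \sum_{l<j} \phi_l \phi_l^T$.\<close>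

lemma elliptical_potential:
  fixes \<phi> :: "nat \<Rightarrow> nat \<Rightarrow> real"
  assumes s: "s > 0"
  shows "\<exists>w :: nat \<Rightarrow> nat \<Rightarrow> real.
    (\<forall>j. \<forall>c<D. s * w j c + (\<Sum>l<j. \<phi> l c * (\<Sum>d<D. \<phi> l d * w j d)) = \<phi> j c) \<and>
    (\<forall>N. (\<Prod>j<N. 1 + (\<Sum>c<D. \<phi> j c * w j c)) \<le> (\<Prod>c<D. 1 + (\<Sum>j<N. (\<phi> j c)\<^sup>2) / s))"
proof -
  define A where "A j = Matrix.mat D D (\<lambda>(c, d). (if c = d then s else 0) + (\<Sum>l<j. \<phi> l c * \<phi> l d))" for j
  define f where "f j = Matrix.mat D 1 (\<lambda>(c, d). \<phi> j c)" for j
  have Ac: "A j \<in> carrier_mat D D" for j by (simp add: A_def)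
  have fc: "f j \<in> carrier_mat D 1" for j by (simp add: f_def)
  have quad: "(\<Sum>c<D. \<Sum>d<D. u c * u d * A j $$ (c, d))
      = s * (\<Sum>c<D. (u c)\<^sup>2) + (\<Sum>l<j. (\<Sum>c<D. u c * \<phi> l c)\<^sup>2)" for j u
  proof -
    have "(\<Sum>c<D. \<Sum>d<D. u c * u d * A j $$ (c, d))
      = (\<Sum>c<D. \<Sum>d<D. u c * u d * ((if c = d then s else 0) + (\<Sum>l<j. \<phi> l c * \<phi> l d)))"
      by (intro sum.cong refl) (simp add: A_def)
    then show ?thesis by (simp only: quadratic_form_add_diag quadratic_form_gram)
  qed
  have coercive: "s * (\<Sum>c<D. (u c)\<^sup>2) \<le> (\<Sum>c<D. \<Sum>d<D. u c * u d * A j $$ (c, d))" for u j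
    unfolding quad by (simp add: sum_nonneg)
  have psd: "psd_mat D (A j)" for j
    unfolding psd_mat_def
  proof (intro conjI allI impI Ac)
    show "A j $$ (c, d) = A j $$ (d, c)" if "c < D" "d < D" for c d
      using that by (simp add: A_def mult.commute)
    show "0 \<le> (\<Sum>c<D. \<Sum>d<D. u c * u d * A j $$ (c, d))" for u
      unfolding quad using s by (simp add: sum_nonneg)
  qed
  have "\<exists>W. W \<in> carrier_mat D 1 \<and> A j * W = f j" for j
  proof -
    from coercive_mat_inverse[OF Ac s coercive] obtain B
      where B: "B \<in> carrier_mat D D" "A j * B = 1\<^sub>m D" by metis
    have "A j * (B * f j) = f j"
      using B assoc_mult_mat[OF Ac B(1) fc] fc by (metis left_mult_one_mat)
    then show ?thesis using B(1) fc by (intro exI[of _ "B * f j"]) auto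
  qed
  then obtain W where W: "\<And>j. W j \<in> carrier_mat D 1" "\<And>j. A j * W j = f j" by metis
  define w where "w j c = W j $$ (c, 0)" for j c
  have eq: "s * w j c + (\<Sum>l<j. \<phi> l c * (\<Sum>d<D. \<phi> l d * w j d)) = \<phi> j c" if "c < D" for j c
  proof -
    have "\<phi> j c = (A j * W j) $$ (c, 0)" using that W by (simp add: f_def)
    also have "\<dots> = (\<Sum>d<D. A j $$ (c, d) * w j d)"
      using that Ac[of j] W(1)[of j] by (simp add: scalar_prod_def w_def lessThan_atLeast0)
    also have "\<dots> = (\<Sum>d<D. (if d = c then s else 0) * w j d + (\<Sum>l<j. \<phi> l c * \<phi> l d) * w j d)"
      using that by (intro sum.cong) (auto simp: A_def distrib_right)
    also have "\<dots> = s * w j c + (\<Sum>d<D. \<Sum>l<j. \<phi> l c * (\<phi> l d * w j d))"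
      using that by (simp add: sum.distrib sum_distrib_right mult.assoc)
    also have "(\<Sum>d<D. \<Sum>l<j. \<phi> l c * (\<phi> l d * w j d)) = (\<Sum>l<j. \<phi> l c * (\<Sum>d<D. \<phi> l d * w j d))"
      by (subst sum.swap) (simp add: sum_distrib_left)
    finally show ?thesis ..
  qed
  \<comment> \<open>The determinant telescopes: A_0 = s I contributes s^D, and adding the feature
    vector number j contributes one factor.\<close>
  have det: "Determinant.det (A N) = s ^ D * (\<Prod>j<N. 1 + (\<Sum>c<D. \<phi> j c * w j c))" for N
  proof (induction N)
    case 0
    have "A 0 = s \<cdot>\<^sub>m 1\<^sub>m D" by (intro eq_matI) (auto simp: A_def)
    then show ?case by simp
  next
    case (Suc N)
    have "A (Suc N) = A N + f N * transpose_mat (f N)"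
      by (intro eq_matI) (auto simp: A_def f_def scalar_prod_def)
    then have "Determinant.det (A (Suc N))
        = Determinant.det (A N) * (1 + (transpose_mat (f N) * W N) $$ (0, 0))"
      by (simp add: det_rank_one_update[OF Ac fc W])
    also have "(transpose_mat (f N) * W N) $$ (0, 0) = (\<Sum>c<D. \<phi> N c * w N c)"
      using W(1)[of N] by (auto simp: f_def w_def scalar_prod_def lessThan_atLeast0 intro!: sum.cong)
    finally show ?case using Suc.IH by (simp add: mult.assoc)
  qed
  have "(\<Prod>j<N. 1 + (\<Sum>c<D. \<phi> j c * w j c)) \<le> (\<Prod>c<D. 1 + (\<Sum>j<N. (\<phi> j c)\<^sup>2) / s)" for N
  proof -
    \<comment> \<open>Hadamard's inequality for A_N, whose diagonal entries are s plus the
      accumulated squares of one feature; the common factor s^D then cancels.\<close>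
    have "s ^ D * (\<Prod>j<N. 1 + (\<Sum>c<D. \<phi> j c * w j c)) \<le> (\<Prod>c<D. A N $$ (c, c))"
      using psd_mat_det(2)[OF psd[of N]] by (simp add: det)
    also have "\<dots> = (\<Prod>c<D. s * (1 + (\<Sum>j<N. (\<phi> j c)\<^sup>2) / s))"
      using s by (intro prod.cong) (auto simp: A_def field_simps power2_eq_square)
    also have "\<dots> = s ^ D * (\<Prod>c<D. 1 + (\<Sum>j<N. (\<phi> j c)\<^sup>2) / s)"
      by (simp add: prod.distrib)
    finally show ?thesis using s by simp
  qed
  with eq show ?thesis by (intro exI[of _ w] conjI allI impI)
qed

section \<open>Predictive covariance\<close>

text \<open>Relative to X because the Gaussian kernel is treated through approximations that are
  uniform on a compact set only. The points z need not be distinct, since trajectories may revisit a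
  point.\<close>

definition psd_kernel_on :: "'a set \<Rightarrow> ('a \<Rightarrow> 'a \<Rightarrow> real) \<Rightarrow> bool" where
  "psd_kernel_on X k \<longleftrightarrow> (\<forall>x\<in>X. \<forall>y\<in>X. k x y = k y x) \<and>
     (\<forall>n z u. z ` {..<n} \<subseteq> X \<longrightarrow> 0 \<le> (\<Sum>i<n. \<Sum>j<n. u i * u j * k (z i) (z (j::nat))))"

lemma sum_lessThan_add:
  fixes f :: "nat \<Rightarrow> 'a::comm_monoid_add"
  shows "sum f {..<m + n} = sum f {..<m} + (\<Sum>i<n. f (m + i))"
  by (induction n) (simp_all add: add.assoc)

text \<open>This is 2 <U, B> <= |U|^2 + |B|^2 for kernel combinations: the two families of points
  are joined into one, with weights u on the first and -b on the second, and the nonnegative form is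
  expanded.\<close>

lemma psd_kernel_on_cross:
  assumes k: "psd_kernel_on X k" and y: "y ` {..<m::nat} \<subseteq> X" and z: "z ` {..<n} \<subseteq> X"
  shows "2 * (\<Sum>a<m. \<Sum>i<n. u a * b i * k (y a) (z i))
    \<le> (\<Sum>a<m. \<Sum>c<m. u a * u c * k (y a) (y c)) + (\<Sum>i<n. \<Sum>j<n. b i * b j * k (z i) (z (j::nat)))"
proof -
  let ?x = "\<lambda>i. if i < m then y i else z (i - m)"
  let ?v = "\<lambda>i. if i < m then u i else - b (i - m)"
  have "?x ` {..<m + n} \<subseteq> X" using y z by (auto simp: image_subset_iff)
  then have "0 \<le> (\<Sum>i<m + n. \<Sum>j<m + n. ?v i * ?v j * k (?x i) (?x j))"
    using k unfolding psd_kernel_on_def by meson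
  also have "\<dots> = (\<Sum>a<m. \<Sum>c<m. u a * u c * k (y a) (y c))
      - (\<Sum>a<m. \<Sum>i<n. u a * b i * k (y a) (z i))
      + ((\<Sum>i<n. \<Sum>j<n. b i * b j * k (z i) (z j))
      - (\<Sum>i<n. \<Sum>a<m. u a * b i * k (z i) (y a)))"
    by (simp add: sum_lessThan_add sum.distrib sum_negf sum_subtractf mult.commute)
  also have "(\<Sum>i<n. \<Sum>a<m. u a * b i * k (z i) (y a)) = (\<Sum>i<n. \<Sum>a<m. u a * b i * k (y a) (z i))"
    using k y z unfolding psd_kernel_on_def by (intro sum.cong refl) (simp add: image_subset_iff)
  also have "\<dots> = (\<Sum>a<m. \<Sum>i<n. u a * b i * k (y a) (z i))" by (rule sum.swap)
  finally show ?thesis by simp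
qed

lemma pred_cov_carrier: "pred_cov k s2 T t \<in> carrier_mat (length t) (length t)"
  by (auto simp: pred_cov_def kernel_mat_def)

text \<open>Trades the matrix inverse for vectors b_a solving (K + s2 I) b_a = k(T, t_a). Everything
  later about \<open>pred_cov\<close> uses only these linear equations. For empty T the equations
  are vacuous and the sums are zero.\<close>

lemma pred_cov_solution:
  assumes k: "psd_kernel_on X k" and s2: "s2 > 0" and T: "set T \<subseteq> X"
  shows "\<exists>b :: nat \<Rightarrow> nat \<Rightarrow> real.
    (\<forall>i<length T. \<forall>a<length t.
       (\<Sum>l<length T. k (T ! i) (T ! l) * b a l) + s2 * b a i = k (T ! i) (t ! a)) \<and>
    (\<forall>a<length t. \<forall>c<length t.
       pred_cov k s2 T t $$ (a, c) = k (t ! a) (t ! c) - (\<Sum>i<length T. k (T ! i) (t ! a) * b c i))"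
proof (cases "T = []")
  case True
  then show ?thesis by (simp add: pred_cov_def kernel_mat_def)
next
  case False
  define N where "N = length T"
  define m where "m = length t"
  define K where "K = kernel_mat k t t"
  define G where "G = kernel_mat k T t"
  define M where "M = kernel_mat k T T + s2 \<cdot>\<^sub>m 1\<^sub>m (length T)"
  have Mc: "M \<in> carrier_mat N N" and Gc: "G \<in> carrier_mat N m" and Kc: "K \<in> carrier_mat m m"
    by (auto simp: M_def G_def K_def N_def m_def kernel_mat_def)
  have Mij: "M $$ (i, j) = (if i = j then s2 else 0) + k (T ! i) (T ! j)" if "i < N" "j < N" for i j
    using that by (simp add: M_def N_def kernel_mat_def)
  have coercive: "s2 * (\<Sum>i<N. (u i)\<^sup>2) \<le> (\<Sum>i<N. \<Sum>j<N. u i * u j * M $$ (i, j))" for u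
  proof -
    have "(!) T ` {..<N} \<subseteq> X" using T by (auto simp: N_def)
    then have "0 \<le> (\<Sum>i<N. \<Sum>j<N. u i * u j * k (T ! i) (T ! j))"
      using k unfolding psd_kernel_on_def by blast
    moreover have "(\<Sum>i<N. \<Sum>j<N. u i * u j * M $$ (i, j))
      = (\<Sum>i<N. \<Sum>j<N. u i * u j * ((if i = j then s2 else 0) + k (T ! i) (T ! j)))"
      by (intro sum.cong refl) (simp add: Mij)
    ultimately show ?thesis by (simp only: quadratic_form_add_diag)
  qed
  from coercive_mat_inverse[OF Mc s2 coercive] obtain I
    where I: "mat_inverse M = Some I" "I \<in> carrier_mat N N" "M * I = 1\<^sub>m N" .
  define B where "B = I * G"
  have Bc: "B \<in> carrier_mat N m" using I(2) Gc by (simp add: B_def)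
  have MB: "M * B = G" unfolding B_def
    using assoc_mult_mat[OF Mc I(2) Gc] I(3) Gc by (metis left_mult_one_mat)
  have "pred_cov k s2 T t = K - transpose_mat G * the (mat_inverse M) * G"
    using False by (simp add: pred_cov_def K_def G_def M_def)
  also have "transpose_mat G * the (mat_inverse M) * G = transpose_mat G * B"
    unfolding B_def using I Gc by (simp add: assoc_mult_mat[of _ m N _ N _ m])
  finally have S: "pred_cov k s2 T t = K - transpose_mat G * B" .
  show ?thesis
  proof (intro exI[of _ "\<lambda>a i. B $$ (i, a)"] conjI allI impI)
    fix i a assume "i < length T" "a < length t"
    then have i: "i < N" and a: "a < m" by (simp_all add: N_def m_def)
    have "k (T ! i) (t ! a) = (M * B) $$ (i, a)"
      unfolding MB using i a by (simp add: G_def kernel_mat_def N_def m_def)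
    also have "\<dots> = (\<Sum>l<N. M $$ (i, l) * B $$ (l, a))"
      using i a Mc Bc by (simp add: scalar_prod_def lessThan_atLeast0)
    also have "\<dots> = (\<Sum>l<N. (if l = i then s2 else 0) * B $$ (l, a) + k (T ! i) (T ! l) * B $$ (l, a))"
      using i by (intro sum.cong) (auto simp: Mij distrib_right)
    also have "\<dots> = (\<Sum>l<N. k (T ! i) (T ! l) * B $$ (l, a)) + s2 * B $$ (i, a)"
      using i by (simp add: sum.distrib)
    finally show "(\<Sum>l<length T. k (T ! i) (T ! l) * B $$ (l, a)) + s2 * B $$ (i, a) = k (T ! i) (t ! a)"
      by (simp add: N_def)
  next
    fix a c assume "a < length t" "c < length t"
    then have a: "a < m" and c: "c < m" by (simp_all add: m_def)
    have "(transpose_mat G * B) $$ (a, c) = (\<Sum>i<N. G $$ (i, a) * B $$ (i, c))"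
      using a c Gc Bc by (simp add: scalar_prod_def lessThan_atLeast0)
    also have "\<dots> = (\<Sum>i<N. k (T ! i) (t ! a) * B $$ (i, c))"
      using a by (intro sum.cong refl) (simp add: G_def kernel_mat_def N_def m_def)
    finally show "pred_cov k s2 T t $$ (a, c)
        = k (t ! a) (t ! c) - (\<Sum>i<length T. k (T ! i) (t ! a) * B $$ (i, c))"
      unfolding S using a c Kc Gc Bc by (simp add: K_def kernel_mat_def m_def N_def)
  qed
qed

text \<open>The predictive variance is the minimum over \<alpha> of a ridge functional, attained at
  the solution vector b_a; any other \<alpha> therefore gives an upper bound. This is what later
  allows a kernel to be replaced by a nearby one without comparing inverses.\<close>

lemma pred_cov_psd_variational:
  assumes k: "psd_kernel_on X k" and s2: "s2 > 0" and T: "set T \<subseteq> X" and t: "set t \<subseteq> X"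
  shows "psd_mat (length t) (pred_cov k s2 T t)"
    and "\<And>a \<alpha>. a < length t \<Longrightarrow> pred_cov k s2 T t $$ (a, a)
      \<le> k (t ! a) (t ! a) - 2 * (\<Sum>i<length T. \<alpha> i * k (T ! i) (t ! a))
        + (\<Sum>i<length T. \<Sum>j<length T. \<alpha> i * \<alpha> j * k (T ! i) (T ! j)) + s2 * (\<Sum>i<length T. (\<alpha> i)\<^sup>2)"
proof -
  define N where "N = length T"
  define m where "m = length t"
  let ?S = "pred_cov k s2 T t"
  have Sc: "?S \<in> carrier_mat m m" unfolding m_def by (rule pred_cov_carrier)
  from pred_cov_solution[OF k s2 T, of t] obtain b
    where "\<forall>i<N. \<forall>a<m. (\<Sum>l<N. k (T ! i) (T ! l) * b a l) + s2 * b a i = k (T ! i) (t ! a)"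
      and "\<forall>a<m. \<forall>c<m. ?S $$ (a, c) = k (t ! a) (t ! c) - (\<Sum>i<N. k (T ! i) (t ! a) * b c i)"
    unfolding N_def m_def by (elim exE conjE)
  then have b: "\<And>i a. i < N \<Longrightarrow> a < m \<Longrightarrow> (\<Sum>l<N. k (T ! i) (T ! l) * b a l) + s2 * b a i = k (T ! i) (t ! a)"
    and S: "\<And>a c. a < m \<Longrightarrow> c < m \<Longrightarrow> ?S $$ (a, c) = k (t ! a) (t ! c) - (\<Sum>i<N. k (T ! i) (t ! a) * b c i)"
    by simp_all
  have TX: "T ! i \<in> X" if "i < N" for i using T that by (auto simp: N_def)
  have tX: "t ! i \<in> X" if "i < m" for i using t that by (auto simp: m_def)
  have ksym: "k x y = k y x" if "x \<in> X" "y \<in> X" for x y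
    using k that unfolding psd_kernel_on_def by blast
  \<comment> \<open>The bilinear form of K + s2 I. By the defining equations, b_a represents the
    functional p -> k(T, t_a) . p with respect to it, so the entries of the covariance are k(t_a,
    t_c) - E(b_a, b_c).\<close>
  define E where "E p q = (\<Sum>i<N. \<Sum>l<N. p i * q l * k (T ! i) (T ! l)) + s2 * (\<Sum>i<N. p i * q i)" for p q
  have E: "(\<Sum>i<N. p i * k (T ! i) (t ! a)) = E p (b a)" if "a < m" for p a
  proof -
    have "(\<Sum>i<N. p i * k (T ! i) (t ! a))
        = (\<Sum>i<N. p i * ((\<Sum>l<N. k (T ! i) (T ! l) * b a l) + s2 * b a i))"
      using b that by simp
    then show ?thesis
      by (simp add: E_def distrib_left sum.distrib sum_distrib_left mult_ac)
  qed
  have Esym: "E p q = E q p" for p q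
  proof -
    have "(\<Sum>i<N. \<Sum>l<N. p i * q l * k (T ! i) (T ! l)) = (\<Sum>i<N. \<Sum>l<N. p i * q l * k (T ! l) (T ! i))"
      by (intro sum.cong refl) (metis ksym TX lessThan_iff)
    also have "\<dots> = (\<Sum>i<N. \<Sum>l<N. q i * p l * k (T ! i) (T ! l))"
      by (subst sum.swap) (simp add: mult.commute)
    finally show ?thesis by (simp add: E_def mult.commute)
  qed
  have Esum: "E p (\<lambda>i. \<Sum>c<m. u c * q c i) = (\<Sum>c<m. u c * E p (q c))" for p u q
  proof -
    have "(\<Sum>i<N. \<Sum>l<N. p i * (\<Sum>c<m. u c * q c l) * k (T ! i) (T ! l))
        = (\<Sum>i<N. \<Sum>l<N. \<Sum>c<m. u c * (p i * q c l * k (T ! i) (T ! l)))"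
      by (simp add: sum_distrib_left sum_distrib_right mult_ac)
    also have "\<dots> = (\<Sum>i<N. \<Sum>c<m. \<Sum>l<N. u c * (p i * q c l * k (T ! i) (T ! l)))"
      by (intro sum.cong refl sum.swap)
    also have "\<dots> = (\<Sum>c<m. u c * (\<Sum>i<N. \<Sum>l<N. p i * q c l * k (T ! i) (T ! l)))"
      by (subst sum.swap) (simp add: sum_distrib_left)
    moreover have "(\<Sum>i<N. p i * (\<Sum>c<m. u c * q c i)) = (\<Sum>c<m. u c * (\<Sum>i<N. p i * q c i))"
      unfolding sum_distrib_left by (subst sum.swap) (simp add: mult_ac)
    ultimately show ?thesis
      by (simp add: E_def sum.distrib distrib_left sum_distrib_left mult_ac)
  qed
  have SE: "?S $$ (a, c) = k (t ! a) (t ! c) - E (b a) (b c)" if "a < m" "c < m" for a c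
    using S[OF that] E[OF that(1), of "b c"] Esym[of "b a" "b c"] by (simp add: mult.commute)
  have Epos: "E p p \<ge> 0" for p
  proof -
    have "(!) T ` {..<N} \<subseteq> X" using TX by auto
    then have "0 \<le> (\<Sum>i<N. \<Sum>j<N. p i * p j * k (T ! i) (T ! j))"
      using k unfolding psd_kernel_on_def by blast
    moreover have "0 \<le> s2 * (\<Sum>i<N. p i * p i)" using s2 by (simp add: sum_nonneg)
    ultimately show ?thesis by (simp add: E_def)
  qed
  show "psd_mat (length t) ?S" unfolding psd_mat_def m_def[symmetric]
  proof (intro conjI allI impI Sc)
    show "?S $$ (a, c) = ?S $$ (c, a)" if "a < m" "c < m" for a c
      using SE[OF that] SE[OF that(2,1)] ksym[OF tX[OF that(1)] tX[OF that(2)]] Esym[of "b a" "b c"]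
      by simp
    fix u
    \<comment> \<open>By bilinearity the subtracted part of the form at u is E(p, p). The cross
      inequality at this p bounds 2 E(p, p) by the form of k at u plus the K-part of E(p, p), and
      the latter is at most E(p, p).\<close>
    define p where "p i = (\<Sum>a<m. u a * b a i)" for i
    have p: "p = (\<lambda>i. \<Sum>a<m. u a * b a i)" by (rule ext) (simp add: p_def)
    have Ep: "(\<Sum>a<m. u a * E r (b a)) = E r p" for r unfolding p Esum ..
    have "(\<Sum>a<m. \<Sum>c<m. u a * u c * ?S $$ (a, c))
        = (\<Sum>a<m. \<Sum>c<m. u a * u c * k (t ! a) (t ! c)) - (\<Sum>a<m. \<Sum>c<m. u a * u c * E (b a) (b c))"
      by (simp add: SE right_diff_distrib sum_subtractf)
    also have "(\<Sum>a<m. \<Sum>c<m. u a * u c * E (b a) (b c)) = (\<Sum>a<m. u a * E (b a) p)"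
      unfolding Ep[symmetric] by (simp add: sum_distrib_left mult.assoc)
    also have "\<dots> = (\<Sum>a<m. u a * E p (b a))" by (intro sum.cong refl arg_cong2[where f = "(*)"] Esym)
    also have "\<dots> = E p p" by (rule Ep)
    finally have 1: "(\<Sum>a<m. \<Sum>c<m. u a * u c * ?S $$ (a, c))
        = (\<Sum>a<m. \<Sum>c<m. u a * u c * k (t ! a) (t ! c)) - E p p" .
    have "(\<Sum>a<m. \<Sum>i<N. u a * p i * k (t ! a) (T ! i)) = (\<Sum>a<m. u a * (\<Sum>i<N. p i * k (T ! i) (t ! a)))"
      using ksym TX tX by (simp add: sum_distrib_left mult.assoc)
    also have "\<dots> = (\<Sum>a<m. u a * E p (b a))" by (intro sum.cong refl) (simp add: E)
    also have "\<dots> = E p p" by (rule Ep)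
    finally have "2 * E p p \<le> (\<Sum>a<m. \<Sum>c<m. u a * u c * k (t ! a) (t ! c))
        + (\<Sum>i<N. \<Sum>j<N. p i * p j * k (T ! i) (T ! j))"
      using psd_kernel_on_cross[OF k, of "(!) t" m "(!) T" N u p] tX TX
      by (auto simp: image_subset_iff)
    moreover have "(\<Sum>i<N. \<Sum>j<N. p i * p j * k (T ! i) (T ! j)) \<le> E p p"
      using s2 by (simp add: E_def sum_nonneg)
    ultimately show "0 \<le> (\<Sum>a<m. \<Sum>c<m. u a * u c * ?S $$ (a, c))" unfolding 1 by simp
  qed
  fix a \<alpha> assume "a < length t"
  then have a: "a < m" by (simp add: m_def)
  \<comment> \<open>The gap in the variational bound is the E-norm of \<alpha> - b_a, which is
    nonnegative.\<close>
  have "E (\<lambda>i. \<alpha> i - b a i) (\<lambda>i. \<alpha> i - b a i)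
      = E \<alpha> \<alpha> - E \<alpha> (b a) - E (b a) \<alpha> + E (b a) (b a)"
    by (simp add: E_def algebra_simps sum.distrib sum_subtractf sum_distrib_left)
  then have "E (b a) (b a) \<ge> 2 * E \<alpha> (b a) - E \<alpha> \<alpha>"
    using Epos[of "\<lambda>i. \<alpha> i - b a i"] Esym[of \<alpha> "b a"] by simp
  then show "?S $$ (a, a)
      \<le> k (t ! a) (t ! a) - 2 * (\<Sum>i<length T. \<alpha> i * k (T ! i) (t ! a))
        + (\<Sum>i<length T. \<Sum>j<length T. \<alpha> i * \<alpha> j * k (T ! i) (T ! j)) + s2 * (\<Sum>i<length T. (\<alpha> i)\<^sup>2)"
    using SE[OF a a] E[OF a, of \<alpha>] by (simp add: E_def N_def power2_eq_square)
qed

section \<open>Feature approximation of the Gaussian kernel\<close>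

text \<open>Diagonalises the form with exactly one square per coordinate. The number of squares
  matters: each will cost one exponential series, and it becomes the exponent d in the feature count
  q^d.\<close>

lemma psd_bilinear_form_sum_of_squares:
  fixes L :: "real^'d^'d"
  assumes sym: "Finite_Cartesian_Product.transpose L = L" and psd: "\<And>v. inner v (L *v v) \<ge> 0"
  obtains l :: "'d \<Rightarrow> real^'d \<Rightarrow> real"
  where "\<And>x y. inner x (L *v y) = (\<Sum>c\<in>UNIV. l c x * l c y)"
proof -
  \<comment> \<open>Completing the square in one coordinate at a time; \<open>b\<close> is the form that remains.\<close>
  have "\<exists>(l :: 'd \<Rightarrow> real^'d \<Rightarrow> real) b. (\<forall>x y. inner x (L *v y) = (\<Sum>c\<in>S. l c x * l c y) + b x y)
      \<and> (\<forall>x y. b x y = b y x) \<and> (\<forall>x. linear (b x)) \<and> (\<forall>x. b x x \<ge> 0)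
      \<and> (\<forall>c\<in>S. \<forall>x. b (axis c 1) x = 0)" if "finite S" for S :: "'d set"
    using that
  proof (induction S)
    case empty
    have "linear (\<lambda>y. inner x (L *v y))" for x
      by (intro linearI) (simp_all add: matrix_vector_right_distrib inner_right_distrib
          matrix_vector_mult_scaleR)
    moreover have "inner x (L *v y) = inner y (L *v x)" for x y
      by (metis dot_lmul_matrix inner_commute sym transpose_matrix_vector)
    ultimately show ?case using psd
      by (intro exI[of _ "\<lambda>_ _. 0"] exI[of _ "\<lambda>x y. inner x (L *v y)"]) auto
  next
    case (insert a S)
    from insert.IH obtain l :: "'d \<Rightarrow> real^'d \<Rightarrow> real" and b
      where l: "\<And>x y. inner x (L *v y) = (\<Sum>c\<in>S. l c x * l c y) + b x y"
        and bsym: "\<And>x y. b x y = b y x" and blin: "\<And>x. linear (b x)"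
        and bpos: "\<And>x. b x x \<ge> 0" and b0: "\<And>c x. c \<in> S \<Longrightarrow> b (axis c 1) x = 0"
      by blast
    define e where "e = (axis a 1 :: real^'d)"
    define \<beta> where "\<beta> = b e e"
    have expand: "b (x + t *\<^sub>R e) (x + t *\<^sub>R e) = b x x + 2 * t * b e x + t\<^sup>2 * \<beta>" for x t
    proof -
      have add: "b u (x + t *\<^sub>R e) = b u x + t * b u e" for u
        using linear_add[OF blin[of u]] linear_scale[OF blin[of u]] by simp
      show ?thesis
        unfolding add by (subst (1 2) bsym, unfold add)
          (simp add: \<beta>_def bsym[of x e] power2_eq_square algebra_simps)
    qed
    show ?case
    proof (cases "\<beta> = 0")
      \<comment> \<open>As for matrices, a semidefinite form that vanishes at e is affine along e,
        hence \<open>b e\<close> is identically zero. The coordinate then needs no square and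
        receives the zero function.\<close>
      case True
      have "b e x = 0" for x
      proof (rule ccontr)
        assume ne: "b e x \<noteq> 0"
        have "0 \<le> b x x + 2 * (- (b x x + 1) / (2 * b e x)) * b e x"
          using bpos[of "x + (- (b x x + 1) / (2 * b e x)) *\<^sub>R e"] unfolding expand
          using True by simp
        also have "\<dots> = - 1" using ne by (simp add: field_simps)
        finally show False by simp
      qed
      then show ?thesis
        using insert.hyps l bsym blin bpos b0
        by (intro exI[of _ "l(a := \<lambda>_. 0)"] exI[of _ b])
          (auto simp: e_def intro!: sum.cong)
    next
      case False
      then have \<beta>: "\<beta> > 0" using bpos[of e] by (simp add: \<beta>_def)
      \<comment> \<open>The Schur complement of b with respect to e. It vanishes on e, and it still
        vanishes on the axes already treated because \<open>b e\<close> is zero there.\<close>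
      define b' where "b' x y = b x y - b e x * b e y / \<beta>" for x y
      define l' where "l' = l(a := \<lambda>x. b e x / sqrt \<beta>)"
      have "inner x (L *v y) = (\<Sum>c\<in>insert a S. l' c x * l' c y) + b' x y" for x y
      proof -
        have "(\<Sum>c\<in>S. l' c x * l' c y) = (\<Sum>c\<in>S. l c x * l c y)"
          using insert.hyps by (intro sum.cong) (auto simp: l'_def)
        then show ?thesis using insert.hyps l[of x y] \<beta> by (simp add: l'_def b'_def)
      qed
      moreover have "b' x y = b' y x" for x y using bsym by (simp add: b'_def mult.commute)
      moreover have "linear (b' x)" for x
        using linear_add[OF blin] linear_scale[OF blin] \<beta>
        by (intro linearI) (simp_all add: b'_def field_simps)
      moreover have "b' x x \<ge> 0" for x
        \<comment> \<open>The shift along e minimises the old form, and the minimum is the new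
          one.\<close>
        using bpos[of "x + (- b e x / \<beta>) *\<^sub>R e"] \<beta> unfolding expand
        by (simp add: b'_def power2_eq_square field_simps)
      moreover have "b' (axis c 1) x = 0" if "c \<in> insert a S" for c x
      proof (cases "c = a")
        case True
        then show ?thesis using \<beta> by (simp add: b'_def flip: e_def) (simp add: \<beta>_def)
      next
        case False
        then have "c \<in> S" using that by simp
        then show ?thesis using b0[of c] bsym[of e] by (simp add: b'_def)
      qed
      ultimately show ?thesis by blast
    qed
  qed
  from this[OF finite[of UNIV]] obtain l :: "'d \<Rightarrow> real^'d \<Rightarrow> real" and b
    where l: "\<And>x y. inner x (L *v y) = (\<Sum>c\<in>UNIV. l c x * l c y) + b x y"
      and bsym: "\<And>x y. b x y = b y x" and blin: "\<And>x. linear (b x)"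
      and b0: "\<And>c x. b (axis c 1) x = 0"
    by auto
  have "b x y = 0" for x y
  proof -
    \<comment> \<open>After all coordinates have been treated the remainder vanishes on every basis
      vector, so by linearity it is zero.\<close>
    have "b x = (\<lambda>_. 0)"
    proof (rule linear_eq_stdbasis[OF blin])
      show "linear (\<lambda>_::real^'d. 0::real)" by (rule linear_zero)
      show "b x i = 0" if "i \<in> Basis" for i
        using that b0 bsym[of x i] by (auto simp: Basis_vec_def)
    qed
    then show ?thesis by (rule fun_cong)
  qed
  then show ?thesis using l that by simp
qed

section \<open>Truncated exponential series and explicit features\<close>

definition exp_trunc :: "nat \<Rightarrow> real \<Rightarrow> real" where
  "exp_trunc q t = (\<Sum>p<q. t ^ p / fact p)"

text \<open>In the tail n >= q the factor exp(2 (n - q)) is at least 1; inserting it bounds the tail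
  by exp(-2 q) times the full series at e^2 |t|. The rate 2 is chosen so that q >= ln n yields an
  error of order n^-2.\<close>

lemma exp_trunc_error: "\<bar>exp t - exp_trunc q t\<bar> \<le> exp (- 2 * real q) * exp (exp 2 * \<bar>t\<bar>)"
proof -
  let ?f = "\<lambda>n. t ^ n / fact n - (if n \<in> {..<q} then t ^ n / fact n else 0)"
  let ?g = "\<lambda>n. exp (- 2 * real q) * ((exp 2 * \<bar>t\<bar>) ^ n / fact n)"
  have "(\<lambda>n. t ^ n / fact n) sums exp t"
    using exp_converges[of t] by (simp add: divide_inverse mult.commute)
  then have f: "?f sums (exp t - exp_trunc q t)"
    unfolding exp_trunc_def by (intro sums_diff sums_If_finite_set) auto
  have "(\<lambda>n. (exp 2 * \<bar>t\<bar>) ^ n / fact n) sums exp (exp 2 * \<bar>t\<bar>)"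
    using exp_converges[of "exp 2 * \<bar>t\<bar>"] by (simp add: divide_inverse mult.commute)
  then have g: "?g sums (exp (- 2 * real q) * exp (exp 2 * \<bar>t\<bar>))"
    by (rule sums_mult)
  have "norm (?f n) \<le> ?g n" for n
  proof (cases "n < q")
    case False
    have "exp (- 2 * real q) * (exp 2 * \<bar>t\<bar>) ^ n = exp (2 * (real n - real q)) * \<bar>t\<bar> ^ n"
      by (simp add: power_mult_distrib right_diff_distrib exp_diff exp_minus field_simps
          flip: exp_of_nat_mult)
    also have "\<dots> \<ge> 1 * \<bar>t\<bar> ^ n" using False by (intro mult_right_mono) auto
    finally have "\<bar>t\<bar> ^ n / fact n \<le> exp (- 2 * real q) * (exp 2 * \<bar>t\<bar>) ^ n / fact n"
      by (intro divide_right_mono) auto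
    then show ?thesis using False by (simp add: power_abs)
  qed simp
  with norm_sums_le[OF f g] show ?thesis by simp
qed

lemma abs_exp_trunc_le: "\<bar>exp_trunc q t\<bar> \<le> exp \<bar>t\<bar>"
proof -
  have "\<bar>exp_trunc q t\<bar> \<le> (\<Sum>p<q. \<bar>t\<bar> ^ p / fact p)"
    unfolding exp_trunc_def by (rule order_trans[OF sum_abs]) (simp add: power_abs)
  also have "\<dots> \<le> (\<Sum>p. \<bar>t\<bar> ^ p / fact p)"
    using summable_exp[of "\<bar>t\<bar>"] by (intro sum_le_suminf) (simp_all add: divide_inverse mult.commute)
  also have "\<dots> = exp \<bar>t\<bar>"
    using exp_converges[of "\<bar>t\<bar>"] by (intro sums_unique[symmetric]) (simp add: divide_inverse mult.commute)
  finally show ?thesis .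
qed

text \<open>Expanding the square in the exponent splits the kernel into e(x) e(y) times a product of
  d factors exp(l_c(x) l_c(y)). Truncating each factor after q terms and multiplying out gives q^d
  products of a function of x and the same function of y. The constant C is uniform in q.\<close>

lemma gauss_kernel_features:
  fixes X :: "(real^'d) set"
  assumes X: "compact X" and sf2: "sf2 > 0" and L2: "sym_pos_def L2"
  shows "\<exists>C\<ge>0. \<forall>q. \<exists>\<psi> :: nat \<Rightarrow> real^'d \<Rightarrow> real.
       (\<forall>x. (\<Sum>c<q ^ CARD('d). (\<psi> c x)\<^sup>2) \<le> sf2) \<and>
       (\<forall>x\<in>X. \<forall>y\<in>X. \<bar>gauss_kernel sf2 L2 x y - (\<Sum>c<q ^ CARD('d). \<psi> c x * \<psi> c y)\<bar>
          \<le> C * exp (- 2 * real q))"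
proof -
  have sym: "Finite_Cartesian_Product.transpose L2 = L2" using L2 by (simp add: sym_pos_def_def)
  have psd: "inner v (L2 *v v) \<ge> 0" for v
    using L2 by (cases "v = 0") (auto simp: sym_pos_def_def less_imp_le)
  obtain l :: "'d \<Rightarrow> real^'d \<Rightarrow> real"
    where l: "\<And>x y. inner x (L2 *v y) = (\<Sum>c\<in>UNIV. l c x * l c y)"
    using psd_bilinear_form_sum_of_squares[OF sym psd] by metis
  have "continuous_on X (\<lambda>x. inner x (L2 *v x))"
    by (intro continuous_intros matrix_vector_mult_linear_continuous_on)
  then have "bounded ((\<lambda>x. inner x (L2 *v x)) ` X)"
    using X compact_continuous_image compact_imp_bounded by blast
  then obtain R where R: "R > 0" "\<And>x. x \<in> X \<Longrightarrow> \<bar>inner x (L2 *v x)\<bar> \<le> R"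
    by (auto simp: bounded_pos)
  have lR: "\<bar>l c x * l c y\<bar> \<le> R" if "x \<in> X" "y \<in> X" for c x y
  proof -
    have "(l c x)\<^sup>2 \<le> R" if "x \<in> X" for x
    proof -
      have "(l c x)\<^sup>2 \<le> (\<Sum>c\<in>UNIV. l c x * l c x)"
        unfolding power2_eq_square by (rule member_le_sum) auto
      then show ?thesis using R(2)[OF that] l[of x x] by simp
    qed
    then have "(l c x)\<^sup>2 \<le> R" "(l c y)\<^sup>2 \<le> R" using that by blast+
    moreover have "2 * \<bar>l c x * l c y\<bar> \<le> (l c x)\<^sup>2 + (l c y)\<^sup>2"
      using sum_squares_bound[of "\<bar>l c x\<bar>" "\<bar>l c y\<bar>"] by (simp add: abs_mult)
    ultimately show ?thesis by simp
  qed
  define e where "e x = exp (- (1/2) * inner x (L2 *v x))" for x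
  have e: "0 < e x" "e x \<le> 1" for x using psd[of x] by (auto simp: e_def)
  have k: "gauss_kernel sf2 L2 x y = sf2 * e x * e y * (\<Prod>c\<in>UNIV. exp (l c x * l c y))" for x y
  proof -
    have "inner (x - y) (L2 *v (x - y))
        = inner x (L2 *v x) - 2 * inner x (L2 *v y) + inner y (L2 *v y)"
      unfolding matrix_vector_mult_diff_distrib inner_diff_left inner_diff_right
      using l[of x y] l[of y x] by (simp add: mult.commute)
    then have "- (1/2) * inner (x - y) (L2 *v (x - y))
        = - (1/2) * inner x (L2 *v x) + - (1/2) * inner y (L2 *v y) + (\<Sum>c\<in>UNIV. l c x * l c y)"
      using l[of x y] by (simp add: field_simps)
    then have "exp (- (1/2) * inner (x - y) (L2 *v (x - y))) = e x * e y * (\<Prod>c\<in>UNIV. exp (l c x * l c y))"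
      by (simp only: e_def exp_add exp_sum[OF finite])
    then show ?thesis unfolding gauss_kernel_def by simp
  qed
  \<comment> \<open>One truncation error for each of the d factors, with exp(R)^d undoing the
    normalisation used in the product estimate below.\<close>
  define C where "C = sf2 * (exp R ^ CARD('d) * (real CARD('d) * exp (exp 2 * R)))"
  have "\<exists>\<psi> :: nat \<Rightarrow> real^'d \<Rightarrow> real.
       (\<forall>x. (\<Sum>c<q ^ CARD('d). (\<psi> c x)\<^sup>2) \<le> sf2) \<and>
       (\<forall>x\<in>X. \<forall>y\<in>X. \<bar>gauss_kernel sf2 L2 x y - (\<Sum>c<q ^ CARD('d). \<psi> c x * \<psi> c y)\<bar>
          \<le> C * exp (- 2 * real q))" for q
  proof -
    \<comment> \<open>The features are indexed by vectors of exponents, one below q for each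
      coordinate; h numbers them by naturals.\<close>
    let ?F = "PiE (UNIV :: 'd set) (\<lambda>_. {..<q})"
    have card: "card ?F = q ^ CARD('d)" by (simp add: card_PiE)
    have "finite ?F" by (simp add: finite_PiE)
    from ex_bij_betw_nat_finite[OF this] obtain h where "bij_betw h {0..<card ?F} ?F" ..
    then have h: "bij_betw h {..<q ^ CARD('d)} ?F" unfolding card lessThan_atLeast0[symmetric] .
    define \<psi>0 where "\<psi>0 f x = sqrt sf2 * e x * (\<Prod>c\<in>UNIV. l c x ^ f c / sqrt (fact (f c)))"
      for f :: "'d \<Rightarrow> nat" and x
    define \<psi> where "\<psi> i = \<psi>0 (h i)" for i
    have k1: "(\<Sum>i<q ^ CARD('d). \<psi> i x * \<psi> i y)
        = sf2 * e x * e y * (\<Prod>c\<in>UNIV. exp_trunc q (l c x * l c y))" for x y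
    proof -
      have "\<psi>0 f x * \<psi>0 f y = sf2 * e x * e y * (\<Prod>c\<in>UNIV. (l c x * l c y) ^ f c / fact (f c))" for f
      proof -
        have "(\<Prod>c\<in>UNIV. l c x ^ f c / sqrt (fact (f c))) * (\<Prod>c\<in>UNIV. l c y ^ f c / sqrt (fact (f c)))
            = (\<Prod>c\<in>UNIV. (l c x * l c y) ^ f c / fact (f c))"
          unfolding prod.distrib[symmetric]
          by (intro prod.cong refl) (simp add: power_mult_distrib)
        moreover have "\<psi>0 f x * \<psi>0 f y = (sqrt sf2 * sqrt sf2) * e x * e y
            * ((\<Prod>c\<in>UNIV. l c x ^ f c / sqrt (fact (f c))) * (\<Prod>c\<in>UNIV. l c y ^ f c / sqrt (fact (f c))))"
          unfolding \<psi>0_def by (simp only: mult_ac)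
        ultimately show ?thesis using sf2 by simp
      qed
      then have "(\<Sum>f\<in>?F. \<psi>0 f x * \<psi>0 f y)
          = sf2 * e x * e y * (\<Prod>c\<in>UNIV. exp_trunc q (l c x * l c y))"
        unfolding exp_trunc_def by (subst prod_sum_PiE) (simp_all add: sum_distrib_left)
      moreover have "(\<Sum>i<q ^ CARD('d). \<psi> i x * \<psi> i y) = (\<Sum>f\<in>?F. \<psi>0 f x * \<psi>0 f y)"
        unfolding \<psi>_def by (rule sum.reindex_bij_betw[OF h])
      ultimately show ?thesis by simp
    qed
    have "(\<Sum>i<q ^ CARD('d). (\<psi> i x)\<^sup>2) \<le> sf2" for x
    proof -
      have "(\<Sum>i<q ^ CARD('d). (\<psi> i x)\<^sup>2) = sf2 * e x * e x * (\<Prod>c\<in>UNIV. exp_trunc q (l c x * l c x))"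
        using k1[of x x] by (simp add: power2_eq_square)
      also have "\<dots> \<le> sf2 * e x * e x * (\<Prod>c\<in>UNIV. exp (l c x * l c x))"
      proof (intro mult_left_mono prod_mono conjI)
        fix c
        show "0 \<le> exp_trunc q (l c x * l c x)"
          unfolding exp_trunc_def by (intro sum_nonneg divide_nonneg_nonneg zero_le_power) auto
        show "exp_trunc q (l c x * l c x) \<le> exp (l c x * l c x)"
          using abs_exp_trunc_le[of q "l c x * l c x"] by simp
      qed (use sf2 e(1)[of x] in auto)
      also have "\<dots> = gauss_kernel sf2 L2 x x" by (simp add: k)
      also have "\<dots> = sf2" by (simp add: gauss_kernel_def)
      finally show ?thesis .
    qed
    moreover have "\<bar>gauss_kernel sf2 L2 x y - (\<Sum>i<q ^ CARD('d). \<psi> i x * \<psi> i y)\<bar> \<le> C * exp (- 2 * real q)"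
      if x: "x \<in> X" and y: "y \<in> X" for x y
    proof -
      let ?t = "\<lambda>c. l c x * l c y"
      let ?E = "exp (- 2 * real q) * exp (exp 2 * R)"
      have t: "\<bar>?t c\<bar> \<le> R" for c by (rule lR[OF x y])
      \<comment> \<open>Dividing every factor by exp(R) brings it into the unit ball, where the
        difference of two products is at most the sum of the differences of their factors.\<close>
      have "exp (?t c) \<le> exp R" for c using t[of c] by simp
      moreover have "\<bar>exp_trunc q (?t c)\<bar> \<le> exp R" for c
        using abs_exp_trunc_le[of q "?t c"] t[of c] by (meson exp_le_cancel_iff order_trans)
      ultimately have "norm ((\<Prod>c\<in>UNIV. exp (?t c) / exp R) - (\<Prod>c\<in>UNIV. exp_trunc q (?t c) / exp R))
          \<le> (\<Sum>c\<in>UNIV. norm (exp (?t c) / exp R - exp_trunc q (?t c) / exp R))"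
        by (intro norm_prod_diff) auto
      also have "\<dots> \<le> (\<Sum>c\<in>(UNIV::'d set). ?E)"
      proof (rule sum_mono)
        fix c
        have "norm (exp (?t c) / exp R - exp_trunc q (?t c) / exp R)
            = \<bar>exp (?t c) - exp_trunc q (?t c)\<bar> / exp R"
          by (simp flip: diff_divide_distrib)
        also have "\<dots> \<le> \<bar>exp (?t c) - exp_trunc q (?t c)\<bar> / 1"
          using R(1) by (intro divide_left_mono) auto
        also have "\<dots> \<le> exp (- 2 * real q) * exp (exp 2 * \<bar>?t c\<bar>)"
          using exp_trunc_error[of "?t c" q] by simp
        also have "\<dots> \<le> ?E" using t[of c] by (intro mult_left_mono) auto
        finally show "norm (exp (?t c) / exp R - exp_trunc q (?t c) / exp R) \<le> ?E" .
      qed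
      also have "\<dots> = real CARD('d) * ?E" by simp
      finally have "\<bar>(\<Prod>c\<in>UNIV. exp (?t c)) - (\<Prod>c\<in>UNIV. exp_trunc q (?t c))\<bar> / exp R ^ CARD('d)
          \<le> real CARD('d) * ?E"
        by (simp add: prod_dividef flip: diff_divide_distrib)
      then have "\<bar>(\<Prod>c\<in>UNIV. exp (?t c)) - (\<Prod>c\<in>UNIV. exp_trunc q (?t c))\<bar>
          \<le> exp R ^ CARD('d) * (real CARD('d) * ?E)"
        by (simp add: pos_divide_le_eq mult.commute)
      then have "(sf2 * e x * e y) * \<bar>(\<Prod>c\<in>UNIV. exp (?t c)) - (\<Prod>c\<in>UNIV. exp_trunc q (?t c))\<bar>
          \<le> sf2 * (exp R ^ CARD('d) * (real CARD('d) * ?E))"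
        using sf2 e[of x] e[of y] mult_mono[of "e x" 1 "e y" 1]
        by (intro mult_mono) (auto simp: mult.assoc)
      also have "\<dots> = C * exp (- 2 * real q)" by (simp add: C_def)
      finally show ?thesis
        unfolding k k1 right_diff_distrib[symmetric] abs_mult
        using sf2 e(1)[of x] e(1)[of y] by simp
    qed
    ultimately show ?thesis by blast
  qed
  moreover have "C \<ge> 0" using sf2 by (simp add: C_def)
  ultimately show ?thesis by (intro exI[of _ C] conjI allI)
qed

text \<open>For fixed points and weights the quadratic form is approximated by that of a Gram
  matrix, which is a sum of squares. The form is thus at least a negative multiple of exp(-2 q) for
  every q, and q tends to infinity.\<close>

lemma psd_kernel_on_gauss:
  fixes X :: "(real^'d) set"
  assumes X: "compact X" and sf2: "sf2 > 0" and L2: "sym_pos_def L2"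
  shows "psd_kernel_on X (gauss_kernel sf2 L2)"
  unfolding psd_kernel_on_def
proof (intro conjI ballI allI impI)
  show "gauss_kernel sf2 L2 x y = gauss_kernel sf2 L2 y x" for x y
  proof -
    have "L2 *v (y - x) = - (L2 *v (x - y))"
      by (simp add: matrix_vector_mult_diff_distrib)
    then have "inner (y - x) (L2 *v (y - x)) = inner (x - y) (L2 *v (x - y))"
      by (simp add: inner_diff_left)
    then show ?thesis by (simp add: gauss_kernel_def)
  qed
  fix n and z :: "nat \<Rightarrow> real^'d" and u :: "nat \<Rightarrow> real"
  assume z: "z ` {..<n} \<subseteq> X"
  let ?k = "gauss_kernel sf2 L2"
  let ?Q = "\<Sum>i<n. \<Sum>j<n. u i * u j * ?k (z i) (z j)"
  obtain C where C: "C \<ge> 0"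
    "\<forall>q. \<exists>\<psi> :: nat \<Rightarrow> real^'d \<Rightarrow> real.
       (\<forall>x. (\<Sum>c<q ^ CARD('d). (\<psi> c x)\<^sup>2) \<le> sf2) \<and>
       (\<forall>x\<in>X. \<forall>y\<in>X. \<bar>?k x y - (\<Sum>c<q ^ CARD('d). \<psi> c x * \<psi> c y)\<bar> \<le> C * exp (- 2 * real q))"
    using gauss_kernel_features[OF assms] by (elim exE conjE)
  define S where "S = (\<Sum>i<n. \<Sum>j<n. \<bar>u i * u j\<bar>)"
  have "- (S * C) * exp (- 2 * real q) \<le> ?Q" for q
  proof -
    from C(2) obtain \<psi> where \<psi>: "\<forall>x\<in>X. \<forall>y\<in>X.
      \<bar>?k x y - (\<Sum>c<q ^ CARD('d). \<psi> c x * \<psi> c y)\<bar> \<le> C * exp (- 2 * real q)"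
      by (elim allE[of _ q] exE conjE)
    let ?k1 = "\<lambda>x y. \<Sum>c<q ^ CARD('d). \<psi> c x * \<psi> c y"
    have "(\<Sum>i<n. \<Sum>j<n. u i * u j * ?k1 (z i) (z j)) = (\<Sum>c<q ^ CARD('d). (\<Sum>i<n. u i * \<psi> c (z i))\<^sup>2)"
      by (rule quadratic_form_gram)
    then have "0 \<le> (\<Sum>i<n. \<Sum>j<n. u i * u j * ?k1 (z i) (z j))" by (simp add: sum_nonneg)
    also have "\<dots> \<le> (\<Sum>i<n. \<Sum>j<n. u i * u j * ?k (z i) (z j) + \<bar>u i * u j\<bar> * (C * exp (- 2 * real q)))"
    proof (intro sum_mono)
      fix i j assume "i \<in> {..<n}" "j \<in> {..<n}"
      then have "z i \<in> X" "z j \<in> X" using z by auto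
      then have "\<bar>?k (z i) (z j) - ?k1 (z i) (z j)\<bar> \<le> C * exp (- 2 * real q)" using \<psi> by blast
      then have "\<bar>u i * u j\<bar> * \<bar>?k (z i) (z j) - ?k1 (z i) (z j)\<bar> \<le> \<bar>u i * u j\<bar> * (C * exp (- 2 * real q))"
        by (rule mult_left_mono) simp
      then show "u i * u j * ?k1 (z i) (z j) \<le> u i * u j * ?k (z i) (z j) + \<bar>u i * u j\<bar> * (C * exp (- 2 * real q))"
        unfolding abs_mult[symmetric] right_diff_distrib by linarith
    qed
    also have "\<dots> = ?Q + S * C * exp (- 2 * real q)"
      by (simp add: sum.distrib S_def sum_distrib_right mult.assoc)
    finally show ?thesis by simp
  qed
  moreover have "(\<lambda>q. - (S * C) * exp (- 2 * real q)) \<longlonglongrightarrow> 0" by real_asymp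
  ultimately show "0 \<le> ?Q" by (intro LIMSEQ_le_const2) auto
qed

section \<open>Sums of predictive variances\<close>

text \<open>From ln(1 + p) >= p / (1 + p) and s (1 + p) <= s + v. It turns a variance s p into the
  logarithm of a determinant factor, so that sums of variances become logarithms of
  products.\<close>

lemma le_ln_one_plus:
  fixes p s v :: real
  assumes "0 \<le> p" "s > 0" "s * p \<le> v"
  shows "s * p \<le> (s + v) * ln (1 + p)"
proof -
  have "ln (1 / (1 + p)) \<le> 1 / (1 + p) - 1"
    using assms(1) by (intro ln_le_minus_one) auto
  then have "p / (1 + p) \<le> ln (1 + p)"
    using assms(1) by (simp add: ln_div field_simps)
  then have "p \<le> (1 + p) * ln (1 + p)"
    using assms(1) by (simp add: pos_divide_le_eq mult.commute)
  then have "s * p \<le> s * ((1 + p) * ln (1 + p))"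
    using assms(2) by (intro mult_left_mono) auto
  also have "\<dots> = (s + s * p) * ln (1 + p)" by (simp add: algebra_simps)
  also have "\<dots> \<le> (s + v) * ln (1 + p)"
    using assms by (intro mult_right_mono) auto
  finally show ?thesis .
qed

text \<open>Here w is the ridge solution in feature space. It provides a test vector \<alpha> for
  the variational bound, with which the functional of the Gram matrix equals s p exactly; passing
  from the Gram matrix to K costs at most \<epsilon> (1 + |\<alpha>|_1)^2.\<close>

lemma variance_le_ridge:
  fixes \<phi> :: "nat \<Rightarrow> nat \<Rightarrow> real" and w :: "nat \<Rightarrow> real" and K :: "nat \<Rightarrow> nat \<Rightarrow> real"
  assumes s: "s > 0" and jN: "j \<le> N" and \<epsilon>: "\<epsilon> \<ge> 0"
    and w: "\<And>c. c < D \<Longrightarrow> s * w c + (\<Sum>l<j. \<phi> l c * (\<Sum>d<D. \<phi> l d * w d)) = \<phi> j c"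
    and v: "(\<Sum>c<D. (\<phi> j c)\<^sup>2) \<le> v"
    and K: "\<And>i l. i \<le> j \<Longrightarrow> l \<le> j \<Longrightarrow> \<bar>K i l - (\<Sum>c<D. \<phi> i c * \<phi> l c)\<bar> \<le> \<epsilon>"
  defines "p \<equiv> \<Sum>c<D. \<phi> j c * w c"
  shows "0 \<le> p" "s * p \<le> v"
    and "\<exists>\<alpha>. K j j - 2 * (\<Sum>i<j. \<alpha> i * K i j) + (\<Sum>i<j. \<Sum>l<j. \<alpha> i * \<alpha> l * K i l) + s * (\<Sum>i<j. (\<alpha> i)\<^sup>2)
      \<le> s * p + 2 * \<epsilon> * (1 + real N * v / s)"
proof -
  \<comment> \<open>The feature-space equation reads phi_j = s w + r, where r is the combination of
    earlier features with these weights.\<close>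
  define \<alpha> where "\<alpha> i = (\<Sum>d<D. \<phi> i d * w d)" for i
  define r where "r c = (\<Sum>i<j. \<alpha> i * \<phi> i c)" for c
  define W where "W = (\<Sum>c<D. (w c)\<^sup>2)"
  define A where "A = (\<Sum>i<j. (\<alpha> i)\<^sup>2)"
  have pos: "W \<ge> 0" "A \<ge> 0" by (simp_all add: W_def A_def sum_nonneg)
  have eq: "s * w c + r c = \<phi> j c" if "c < D" for c
    using w[OF that] by (simp add: r_def \<alpha>_def mult.commute)
  have rw: "(\<Sum>c<D. r c * w c) = A"
  proof -
    have "(\<Sum>c<D. r c * w c) = (\<Sum>c<D. \<Sum>i<j. \<alpha> i * (\<phi> i c * w c))"
      by (simp add: r_def sum_distrib_right mult.assoc)
    also have "\<dots> = (\<Sum>i<j. \<alpha> i * \<alpha> i)"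
      unfolding \<alpha>_def by (subst sum.swap) (simp add: sum_distrib_left)
    finally show ?thesis by (simp add: A_def power2_eq_square)
  qed
  have p: "p = s * W + A"
  proof -
    have "p = (\<Sum>c<D. s * (w c)\<^sup>2 + r c * w c)"
      unfolding p_def by (intro sum.cong refl) (simp add: eq[symmetric] power2_eq_square algebra_simps)
    then show ?thesis by (simp add: sum.distrib rw W_def sum_distrib_left)
  qed
  then show "0 \<le> p" using s pos by simp
  have "(\<Sum>c<D. (\<phi> j c)\<^sup>2) = (\<Sum>c<D. s\<^sup>2 * (w c)\<^sup>2 + 2 * s * (r c * w c) + (r c)\<^sup>2)"
    by (intro sum.cong refl) (simp add: eq[symmetric] power2_eq_square algebra_simps)
  also have "\<dots> = s\<^sup>2 * W + 2 * s * A + (\<Sum>c<D. (r c)\<^sup>2)"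
    by (simp add: sum.distrib W_def flip: sum_distrib_left) (simp add: rw)
  also have "\<dots> \<ge> s * p"
    using s pos by (simp add: p power2_eq_square algebra_simps sum_nonneg)
  finally show spv: "s * p \<le> v" using v by simp
  have sA: "s * A \<le> s * p" using s pos by (simp add: p)
  let ?G = "\<lambda>i l. \<Sum>c<D. \<phi> i c * \<phi> l c"
  let ?a = "\<Sum>i<j. \<bar>\<alpha> i\<bar>"
  have G: "?G j j - 2 * (\<Sum>i<j. \<alpha> i * ?G i j) + (\<Sum>i<j. \<Sum>l<j. \<alpha> i * \<alpha> l * ?G i l) + s * A = s * p"
  proof -
    have 1: "(\<Sum>i<j. \<alpha> i * ?G i j) = (\<Sum>c<D. r c * \<phi> j c)"
      unfolding r_def sum_distrib_left sum_distrib_right by (subst sum.swap) (simp add: mult.assoc)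
    have 2: "(\<Sum>i<j. \<Sum>l<j. \<alpha> i * \<alpha> l * ?G i l) = (\<Sum>c<D. (r c)\<^sup>2)"
      unfolding r_def by (rule quadratic_form_gram[where \<phi> = "\<lambda>c i. \<phi> i c"])
    \<comment> \<open>This is the squared residual |phi_j - r|^2 = s^2 |w|^2.\<close>
    have "?G j j - 2 * (\<Sum>c<D. r c * \<phi> j c) + (\<Sum>c<D. (r c)\<^sup>2) = (\<Sum>c<D. s\<^sup>2 * (w c)\<^sup>2)"
      unfolding sum_distrib_left sum_subtractf[symmetric] sum.distrib[symmetric]
      by (intro sum.cong refl) (simp add: eq[symmetric] power2_eq_square algebra_simps)
    also have "\<dots> = s\<^sup>2 * W" by (simp add: W_def sum_distrib_left)
    finally show ?thesis unfolding 1 2 p by (simp add: power2_eq_square algebra_simps)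
  qed
  \<comment> \<open>The replacement is made separately in the constant, linear and quadratic parts
    in \<alpha>.\<close>
  have e0: "K j j \<le> ?G j j + \<epsilon>" using K[of j j] by linarith
  have e1: "(\<Sum>i<j. \<alpha> i * ?G i j) - ?a * \<epsilon> \<le> (\<Sum>i<j. \<alpha> i * K i j)"
    unfolding sum_distrib_right sum_subtractf[symmetric]
  proof (rule sum_mono)
    fix i assume "i \<in> {..<j}"
    then have "\<bar>\<alpha> i\<bar> * \<bar>K i j - ?G i j\<bar> \<le> \<bar>\<alpha> i\<bar> * \<epsilon>" using K by (intro mult_left_mono) auto
    then show "\<alpha> i * ?G i j - \<bar>\<alpha> i\<bar> * \<epsilon> \<le> \<alpha> i * K i j"
      unfolding abs_mult[symmetric] right_diff_distrib by linarith
  qed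
  have e2: "(\<Sum>i<j. \<Sum>l<j. \<alpha> i * \<alpha> l * K i l) \<le> (\<Sum>i<j. \<Sum>l<j. \<alpha> i * \<alpha> l * ?G i l) + ?a\<^sup>2 * \<epsilon>"
  proof -
    have "?a\<^sup>2 * \<epsilon> = (\<Sum>i<j. \<Sum>l<j. \<bar>\<alpha> i * \<alpha> l\<bar> * \<epsilon>)"
      by (simp add: power2_eq_square sum_product abs_mult) (simp add: sum_distrib_right)
    moreover have "(\<Sum>i<j. \<Sum>l<j. \<alpha> i * \<alpha> l * K i l)
        \<le> (\<Sum>i<j. \<Sum>l<j. \<alpha> i * \<alpha> l * ?G i l + \<bar>\<alpha> i * \<alpha> l\<bar> * \<epsilon>)"
    proof (intro sum_mono)
      fix i l assume "i \<in> {..<j}" "l \<in> {..<j}"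
      then have "\<bar>\<alpha> i * \<alpha> l\<bar> * \<bar>K i l - ?G i l\<bar> \<le> \<bar>\<alpha> i * \<alpha> l\<bar> * \<epsilon>"
        using K by (intro mult_left_mono) auto
      then show "\<alpha> i * \<alpha> l * K i l \<le> \<alpha> i * \<alpha> l * ?G i l + \<bar>\<alpha> i * \<alpha> l\<bar> * \<epsilon>"
        unfolding abs_mult[of "\<alpha> i * \<alpha> l", symmetric] right_diff_distrib by linarith
    qed
    ultimately show ?thesis by (simp add: sum.distrib)
  qed
  have "?a\<^sup>2 \<le> real j * A"
    using Cauchy_Schwarz_ineq_sum[of "\<lambda>_. 1" "\<lambda>i. \<bar>\<alpha> i\<bar>" "{..<j}"] by (simp add: A_def)
  also have "\<dots> \<le> real N * (v / s)"
  proof (rule mult_mono)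
    have "s * A \<le> v" using sA spv by linarith
    then show "A \<le> v / s" using s by (simp add: pos_le_divide_eq mult.commute)
  qed (use jN pos in auto)
  finally have a2: "?a\<^sup>2 \<le> real N * v / s" by simp
  \<comment> \<open>(1 + a)^2 <= 2 (1 + a^2), where a^2 was bounded by Cauchy-Schwarz and s A <= s p
    <= v.\<close>
  have "1 + 2 * ?a + ?a\<^sup>2 \<le> 2 * (1 + real N * v / s)"
    using a2 sum_squares_bound[of 1 ?a] by simp
  then have "(1 + 2 * ?a + ?a\<^sup>2) * \<epsilon> \<le> 2 * (1 + real N * v / s) * \<epsilon>"
    using \<epsilon> by (rule mult_right_mono)
  then have "K j j - 2 * (\<Sum>i<j. \<alpha> i * K i j) + (\<Sum>i<j. \<Sum>l<j. \<alpha> i * \<alpha> l * K i l) + s * A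
      \<le> s * p + 2 * \<epsilon> * (1 + real N * v / s)"
    using e0 e1 e2 G by (simp add: algebra_simps)
  then show "\<exists>\<alpha>. K j j - 2 * (\<Sum>i<j. \<alpha> i * K i j) + (\<Sum>i<j. \<Sum>l<j. \<alpha> i * \<alpha> l * K i l)
      + s * (\<Sum>i<j. (\<alpha> i)\<^sup>2) \<le> s * p + 2 * \<epsilon> * (1 + real N * v / s)"
    unfolding A_def by blast
qed

text \<open>Each variance is at most (s + v) ln(1 + p_j) plus the approximation error, and
  \<open>elliptical_potential\<close> bounds the product of the 1 + p_j by D factors of size 1 + N v
  / s. Nonnegativity of the bounds b is recorded so that a sum over selected indices can be enlarged
  to all of them.\<close>

lemma sum_variance_bound:
  fixes \<phi> K :: "nat \<Rightarrow> nat \<Rightarrow> real"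
  assumes s: "s > 0" and \<epsilon>: "\<epsilon> \<ge> 0" and v0: "v \<ge> 0"
    and v: "\<And>j. j < N \<Longrightarrow> (\<Sum>c<D. (\<phi> j c)\<^sup>2) \<le> v"
    and K: "\<And>i l. i < N \<Longrightarrow> l < N \<Longrightarrow> \<bar>K i l - (\<Sum>c<D. \<phi> i c * \<phi> l c)\<bar> \<le> \<epsilon>"
  shows "\<exists>b :: nat \<Rightarrow> real. (\<forall>j<N. 0 \<le> b j) \<and>
    (\<forall>j<N. \<exists>\<alpha>. K j j - 2 * (\<Sum>i<j. \<alpha> i * K i j) + (\<Sum>i<j. \<Sum>l<j. \<alpha> i * \<alpha> l * K i l)
        + s * (\<Sum>i<j. (\<alpha> i)\<^sup>2) \<le> b j) \<and>
    (\<Sum>j<N. b j) \<le> (s + v) * (real D * ln (1 + real N * v / s)) + real N * (2 * \<epsilon> * (1 + real N * v / s))"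
proof -
  obtain w :: "nat \<Rightarrow> nat \<Rightarrow> real" where
    w: "\<forall>j. \<forall>c<D. s * w j c + (\<Sum>l<j. \<phi> l c * (\<Sum>d<D. \<phi> l d * w j d)) = \<phi> j c"
    and prod: "\<forall>N. (\<Prod>j<N. 1 + (\<Sum>c<D. \<phi> j c * w j c)) \<le> (\<Prod>c<D. 1 + (\<Sum>j<N. (\<phi> j c)\<^sup>2) / s)"
    using elliptical_potential[OF s, of D \<phi>] by (elim exE conjE)
  define p where "p j = (\<Sum>c<D. \<phi> j c * w j c)" for j
  let ?e = "2 * \<epsilon> * (1 + real N * v / s)"
  define b where "b j = (s + v) * ln (1 + p j) + ?e" for j
  have r: "0 \<le> p j" "s * p j \<le> v"
    "\<exists>\<alpha>. K j j - 2 * (\<Sum>i<j. \<alpha> i * K i j) + (\<Sum>i<j. \<Sum>l<j. \<alpha> i * \<alpha> l * K i l) + s * (\<Sum>i<j. (\<alpha> i)\<^sup>2)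
      \<le> s * p j + ?e" if j: "j < N" for j
  proof -
    have w': "\<And>c. c < D \<Longrightarrow> s * w j c + (\<Sum>l<j. \<phi> l c * (\<Sum>d<D. \<phi> l d * w j d)) = \<phi> j c"
      using w by blast
    have K': "\<And>i l. i \<le> j \<Longrightarrow> l \<le> j \<Longrightarrow> \<bar>K i l - (\<Sum>c<D. \<phi> i c * \<phi> l c)\<bar> \<le> \<epsilon>"
      using K j by simp
    note ridge = variance_le_ridge[OF s less_imp_le[OF j] \<epsilon> w' v[OF j] K', folded p_def]
    show "0 \<le> p j" by (rule ridge(1))
    show "s * p j \<le> v" by (rule ridge(2))
    show "\<exists>\<alpha>. K j j - 2 * (\<Sum>i<j. \<alpha> i * K i j) + (\<Sum>i<j. \<Sum>l<j. \<alpha> i * \<alpha> l * K i l) + s * (\<Sum>i<j. (\<alpha> i)\<^sup>2)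
      \<le> s * p j + ?e" by (rule ridge(3))
  qed
  have "0 \<le> b j" if "j < N" for j
    unfolding b_def using r(1)[OF that] s \<epsilon> v0
    by (intro add_nonneg_nonneg mult_nonneg_nonneg) auto
  moreover have "\<exists>\<alpha>. K j j - 2 * (\<Sum>i<j. \<alpha> i * K i j) + (\<Sum>i<j. \<Sum>l<j. \<alpha> i * \<alpha> l * K i l)
        + s * (\<Sum>i<j. (\<alpha> i)\<^sup>2) \<le> b j" if "j < N" for j
    using r(3)[OF that] le_ln_one_plus[OF r(1)[OF that] s r(2)[OF that]]
    unfolding b_def by (meson add_right_mono order_trans)
  moreover have "(\<Sum>j<N. b j) \<le> (s + v) * (real D * ln (1 + real N * v / s)) + real N * ?e"
  proof -
    have "(\<Sum>j<N. ln (1 + p j)) = ln (\<Prod>j<N. 1 + p j)"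
      using r(1) by (subst ln_prod) (auto simp: add_nonneg_eq_0_iff)
    also have "\<dots> \<le> ln ((1 + real N * v / s) ^ D)"
    proof (rule ln_mono)
      show "0 < (\<Prod>j<N. 1 + p j)" using r(1) by (intro prod_pos) (auto intro: add_pos_nonneg)
      have "(\<Prod>j<N. 1 + p j) \<le> (\<Prod>c<D. 1 + (\<Sum>j<N. (\<phi> j c)\<^sup>2) / s)"
        using prod by (simp add: p_def)
      also have "\<dots> \<le> (\<Prod>c<D. 1 + real N * v / s)"
      proof (rule prod_mono)
        fix c assume c: "c \<in> {..<D}"
        have "(\<Sum>j<N. (\<phi> j c)\<^sup>2) \<le> (\<Sum>j<N. v)"
        proof (rule sum_mono)
          fix j assume "j \<in> {..<N}"
          then have "(\<Sum>c<D. (\<phi> j c)\<^sup>2) \<le> v" using v by simp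
          moreover have "(\<phi> j c)\<^sup>2 \<le> (\<Sum>c<D. (\<phi> j c)\<^sup>2)" using c by (intro member_le_sum) auto
          ultimately show "(\<phi> j c)\<^sup>2 \<le> v" by linarith
        qed
        then show "0 \<le> 1 + (\<Sum>j<N. (\<phi> j c)\<^sup>2) / s \<and> 1 + (\<Sum>j<N. (\<phi> j c)\<^sup>2) / s \<le> 1 + real N * v / s"
          using s by (auto intro!: divide_right_mono add_nonneg_nonneg divide_nonneg_pos sum_nonneg)
      qed
      finally show "(\<Prod>j<N. 1 + p j) \<le> (1 + real N * v / s) ^ D" by simp
    qed
    also have "\<dots> = real D * ln (1 + real N * v / s)"
      by (rule ln_realpow)
    finally have "(s + v) * (\<Sum>j<N. ln (1 + p j)) \<le> (s + v) * (real D * ln (1 + real N * v / s))"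
      using s v0 by (intro mult_left_mono) auto
    then show ?thesis by (simp add: b_def sum.distrib sum_distrib_left)
  qed
  ultimately show ?thesis by blast
qed

section \<open>From variances of points to determinants of trajectories\<close>

text \<open>In Hadamard's bound only the first diagonal entry is kept. For the first point of a
  trajectory the observations T are exactly all earlier points, which matches the pointwise
  variances summed before; the other m entries are bounded by v.\<close>

lemma det_pred_cov_bounds:
  assumes k: "psd_kernel_on X k" and s2: "s2 > 0" and T: "set T \<subseteq> X" and t: "set t \<subseteq> X"
    and v: "\<And>x. x \<in> X \<Longrightarrow> k x x \<le> v" and len: "length t = Suc m"
  shows "0 \<le> Determinant.det (pred_cov k s2 T t)"
    and "\<And>\<alpha>. Determinant.det (pred_cov k s2 T t)
      \<le> v ^ m * (k (t ! 0) (t ! 0) - 2 * (\<Sum>i<length T. \<alpha> i * k (T ! i) (t ! 0))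
        + (\<Sum>i<length T. \<Sum>j<length T. \<alpha> i * \<alpha> j * k (T ! i) (T ! j)) + s2 * (\<Sum>i<length T. (\<alpha> i)\<^sup>2))"
proof -
  let ?S = "pred_cov k s2 T t"
  note psd = pred_cov_psd_variational(1)[OF k s2 T t] and var = pred_cov_psd_variational(2)[OF k s2 T t]
  show "0 \<le> Determinant.det ?S" by (rule psd_mat_det(1)[OF psd])
  fix \<alpha>
  let ?q = "k (t ! 0) (t ! 0) - 2 * (\<Sum>i<length T. \<alpha> i * k (T ! i) (t ! 0))
        + (\<Sum>i<length T. \<Sum>j<length T. \<alpha> i * \<alpha> j * k (T ! i) (T ! j)) + s2 * (\<Sum>i<length T. (\<alpha> i)\<^sup>2)"
  have d0: "0 \<le> ?S $$ (a, a)" if "a < Suc m" for a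
    using psd_mat_diag_nonneg[OF psd] that len by simp
  have dv: "?S $$ (a, a) \<le> v" if "a < Suc m" for a
  proof -
    have "t ! a \<in> X" using t that len by (auto dest: nth_mem)
    \<comment> \<open>\<alpha> = 0 in the variational bound: conditioning does not increase the
      prior variance.\<close>
    moreover have "?S $$ (a, a) \<le> k (t ! a) (t ! a)"
      using var[of a "\<lambda>_. 0"] that len by simp
    ultimately show ?thesis using v by fastforce
  qed
  have "Determinant.det ?S \<le> (\<Prod>i<Suc m. ?S $$ (i, i))"
    using psd_mat_det(2)[OF psd] len by simp
  also have "\<dots> = ?S $$ (0, 0) * (\<Prod>i<m. ?S $$ (Suc i, Suc i))"
    by (rule prod.lessThan_Suc_shift)
  also have "\<dots> \<le> ?q * (\<Prod>i<m. v)"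
  proof (intro mult_mono prod_mono conjI prod_nonneg)
    show q: "?S $$ (0, 0) \<le> ?q" using var[of 0 \<alpha>] len by simp
    show "0 \<le> ?q" using q d0[of 0] by linarith
  qed (use d0 dv in auto)
  finally show "Determinant.det ?S \<le> v ^ m * ?q" by (simp add: mult.commute)
qed

text \<open>Puts all points on one time axis: point j has position j mod m in the trajectory
  numbered j div m + 1. The history before a trajectory is then an initial segment, as the pointwise
  variance bounds require.\<close>

lemma concat_executed:
  assumes "\<And>i. i \<ge> 1 \<Longrightarrow> length (\<tau> i) = m"
  shows "concat (executed \<tau> (Suc n)) = map (\<lambda>j. \<tau> (Suc (j div m)) ! (j mod m)) [0..<n * m]"
proof (induction n)
  case 0
  then show ?case by (simp add: executed_def)
next
  case (Suc n)
  let ?z = "\<lambda>j. \<tau> (Suc (j div m)) ! (j mod m)"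
  have "\<tau> (Suc n) = map ?z [n * m..<n * m + m]"
    using assms[of "Suc n"] by (intro nth_equalityI) auto
  moreover have "[0..<Suc n * m] = [0..<n * m] @ [n * m..<n * m + m]"
    using upt_add_eq_append[of 0 "n * m" m] by (simp add: add.commute)
  ultimately show ?case using Suc.IH by (simp add: executed_def)
qed

text \<open>Applies the pointwise bound to the flattened sequence of points. The order q stays free
  and C depends on neither n nor q, so q may later be chosen in terms of n.\<close>

lemma sum_det_gauss_le:
  fixes X :: "(real^'d) set" and \<tau> :: "nat \<Rightarrow> (real^'d) list"
  assumes X: "compact X" and sf2: "sf2 > 0" and L2: "sym_pos_def L2" and s2: "s2 > 0"
    and len: "\<forall>i\<ge>1. length (\<tau> i) = Suc m" and \<tau>X: "\<forall>i\<ge>1. set (\<tau> i) \<subseteq> X"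
  shows "\<exists>C\<ge>0. \<forall>n q. (\<Sum>i = 1..n. Determinant.det (step_cov (gauss_kernel sf2 L2) s2 \<tau> i (\<tau> i)))
    \<le> sf2 ^ m * ((s2 + sf2) * (real (q ^ CARD('d)) * ln (1 + real (n * Suc m) * sf2 / s2))
        + real (n * Suc m) * (2 * (C * exp (- 2 * real q)) * (1 + real (n * Suc m) * sf2 / s2)))"
proof -
  let ?k = "gauss_kernel sf2 L2"
  define z where "z j = \<tau> (Suc (j div Suc m)) ! (j mod Suc m)" for j
  have zX: "z j \<in> X" for j
    using \<tau>X[rule_format, of "Suc (j div Suc m)"] len[rule_format, of "Suc (j div Suc m)"] by (auto simp: z_def dest: nth_mem)
  have executed: "concat (executed \<tau> (Suc n)) = map z [0..<n * Suc m]" for n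
    unfolding z_def by (rule concat_executed) (use len in simp)
  have kdiag: "?k x x = sf2" for x by (simp add: gauss_kernel_def)
  note psd = psd_kernel_on_gauss[OF X sf2 L2]
  obtain C where C0: "C \<ge> 0" and C: "\<forall>q. \<exists>\<psi> :: nat \<Rightarrow> real^'d \<Rightarrow> real.
       (\<forall>x. (\<Sum>c<q ^ CARD('d). (\<psi> c x)\<^sup>2) \<le> sf2) \<and>
       (\<forall>x\<in>X. \<forall>y\<in>X. \<bar>?k x y - (\<Sum>c<q ^ CARD('d). \<psi> c x * \<psi> c y)\<bar> \<le> C * exp (- 2 * real q))"
    using gauss_kernel_features[OF X sf2 L2] by (elim exE conjE)
  have "(\<Sum>i = 1..n. Determinant.det (step_cov ?k s2 \<tau> i (\<tau> i)))
    \<le> sf2 ^ m * ((s2 + sf2) * (real (q ^ CARD('d)) * ln (1 + real (n * Suc m) * sf2 / s2))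
        + real (n * Suc m) * (2 * (C * exp (- 2 * real q)) * (1 + real (n * Suc m) * sf2 / s2)))" for n q
  proof -
    from C obtain \<psi> where \<psi>: "\<forall>x. (\<Sum>c<q ^ CARD('d). (\<psi> c x)\<^sup>2) \<le> sf2"
      "\<forall>x\<in>X. \<forall>y\<in>X. \<bar>?k x y - (\<Sum>c<q ^ CARD('d). \<psi> c x * \<psi> c y)\<bar> \<le> C * exp (- 2 * real q)"
      by (elim allE[of _ q] exE conjE)
    let ?N = "n * Suc m"
    have "\<exists>b :: nat \<Rightarrow> real. (\<forall>j<?N. 0 \<le> b j) \<and>
      (\<forall>j<?N. \<exists>\<alpha>. ?k (z j) (z j) - 2 * (\<Sum>i<j. \<alpha> i * ?k (z i) (z j))
          + (\<Sum>i<j. \<Sum>l<j. \<alpha> i * \<alpha> l * ?k (z i) (z l)) + s2 * (\<Sum>i<j. (\<alpha> i)\<^sup>2) \<le> b j) \<and>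
      (\<Sum>j<?N. b j) \<le> (s2 + sf2) * (real (q ^ CARD('d)) * ln (1 + real ?N * sf2 / s2))
        + real ?N * (2 * (C * exp (- 2 * real q)) * (1 + real ?N * sf2 / s2))"
      by (rule sum_variance_bound[where \<phi> = "\<lambda>j c. \<psi> c (z j)"]) (use s2 C0 sf2 \<psi> zX in auto)
    then obtain b :: "nat \<Rightarrow> real" where b0: "\<forall>j<?N. 0 \<le> b j"
      and b: "\<forall>j<?N. \<exists>\<alpha>. ?k (z j) (z j) - 2 * (\<Sum>i<j. \<alpha> i * ?k (z i) (z j))
          + (\<Sum>i<j. \<Sum>l<j. \<alpha> i * \<alpha> l * ?k (z i) (z l)) + s2 * (\<Sum>i<j. (\<alpha> i)\<^sup>2) \<le> b j"
      and bsum: "(\<Sum>j<?N. b j) \<le> (s2 + sf2) * (real (q ^ CARD('d)) * ln (1 + real ?N * sf2 / s2))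
        + real ?N * (2 * (C * exp (- 2 * real q)) * (1 + real ?N * sf2 / s2))"
      by (elim exE conjE)
    have "Determinant.det (step_cov ?k s2 \<tau> (Suc i) (\<tau> (Suc i))) \<le> sf2 ^ m * b (i * Suc m)" if i: "i < n" for i
    proof -
      let ?j = "i * Suc m"
      let ?T = "map z [0..<?j]"
      have "?j < ?N" using i by (simp del: mult_Suc_right)
      with b obtain \<alpha> where \<alpha>: "?k (z ?j) (z ?j) - 2 * (\<Sum>i<?j. \<alpha> i * ?k (z i) (z ?j))
          + (\<Sum>i<?j. \<Sum>l<?j. \<alpha> i * \<alpha> l * ?k (z i) (z l)) + s2 * (\<Sum>i<?j. (\<alpha> i)\<^sup>2) \<le> b ?j"
        by (elim allE[of _ ?j] impE exE)
      \<comment> \<open>Trajectories are numbered from 1 but points from 0, so trajectory i + 1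
        begins at flat index i (m + 1).\<close>
      have z0: "\<tau> (Suc i) ! 0 = z ?j" by (simp add: z_def del: mult_Suc_right)
      have "Determinant.det (pred_cov ?k s2 ?T (\<tau> (Suc i)))
        \<le> sf2 ^ m * (?k (\<tau> (Suc i) ! 0) (\<tau> (Suc i) ! 0)
          - 2 * (\<Sum>l<length ?T. \<alpha> l * ?k (?T ! l) (\<tau> (Suc i) ! 0))
          + (\<Sum>p<length ?T. \<Sum>l<length ?T. \<alpha> p * \<alpha> l * ?k (?T ! p) (?T ! l))
          + s2 * (\<Sum>l<length ?T. (\<alpha> l)\<^sup>2))"
        by (rule det_pred_cov_bounds(2)[OF psd s2]) (use \<tau>X len zX kdiag in auto)
      also have "\<dots> \<le> sf2 ^ m * b ?j"
        using \<alpha> sf2 unfolding z0 by (intro mult_left_mono) (simp_all del: mult_Suc_right)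
      finally show ?thesis by (simp only: step_cov_def executed)
    qed
    then have "(\<Sum>i<n. Determinant.det (step_cov ?k s2 \<tau> (Suc i) (\<tau> (Suc i)))) \<le> (\<Sum>i<n. sf2 ^ m * b (i * Suc m))"
      by (intro sum_mono) simp
    also have "\<dots> = sf2 ^ m * (\<Sum>j\<in>(\<lambda>i. i * Suc m) ` {..<n}. b j)"
      by (subst sum.reindex) (auto simp: inj_on_def sum_distrib_left simp del: mult_Suc_right)
    \<comment> \<open>From the indices of first points to all indices, adding nonnegative
      terms.\<close>
    also have "\<dots> \<le> sf2 ^ m * (\<Sum>j<?N. b j)"
    proof (intro mult_left_mono sum_mono2)
      show "(\<lambda>i. i * Suc m) ` {..<n} \<subseteq> {..<?N}" by (auto simp del: mult_Suc_right)
    qed (use b0 sf2 in auto)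
    also have "\<dots> \<le> sf2 ^ m * ((s2 + sf2) * (real (q ^ CARD('d)) * ln (1 + real ?N * sf2 / s2))
        + real ?N * (2 * (C * exp (- 2 * real q)) * (1 + real ?N * sf2 / s2)))"
      using bsum sf2 by (intro mult_left_mono) auto
    finally show ?thesis
      by (simp add: sum.atLeast_Suc_atMost_Suc_shift atLeast0AtMost lessThan_Suc_atMost[symmetric]
          sum.atLeast1_atMost_eq del: mult_Suc_right)
  qed
  with C0 show ?thesis by (intro exI[of _ C] conjI allI)
qed

lemma sum_det_gauss_bigo:
  fixes X :: "(real^'d) set" and \<tau> :: "nat \<Rightarrow> (real^'d) list"
  assumes X: "compact X" and sf2: "sf2 > 0" and L2: "sym_pos_def L2" and s2: "s2 > 0"
    and len: "\<forall>i\<ge>1. length (\<tau> i) = Suc m" and \<tau>X: "\<forall>i\<ge>1. set (\<tau> i) \<subseteq> X"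
  shows "\<exists>B. \<forall>n\<ge>3. (\<Sum>i = 1..n. Determinant.det (step_cov (gauss_kernel sf2 L2) s2 \<tau> i (\<tau> i)))
    \<le> B * ln (real n) ^ (CARD('d) + 1)"
proof -
  define A where "A = real (Suc m) * sf2 / s2"
  have A: "A > 0" using sf2 s2 by (simp add: A_def)
  obtain C where C0: "C \<ge> 0" and C: "\<forall>n q. (\<Sum>i = 1..n. Determinant.det (step_cov (gauss_kernel sf2 L2) s2 \<tau> i (\<tau> i)))
    \<le> sf2 ^ m * ((s2 + sf2) * (real (q ^ CARD('d)) * ln (1 + real (n * Suc m) * sf2 / s2))
        + real (n * Suc m) * (2 * (C * exp (- 2 * real q)) * (1 + real (n * Suc m) * sf2 / s2)))"
    using sum_det_gauss_le[OF assms] by (elim exE conjE)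
  define B1 where "B1 = (s2 + sf2) * (2 ^ CARD('d) * (1 + ln (1 + A)))"
  define B2 where "B2 = real (Suc m) * (2 * C * (1 + A))"
  have "(\<Sum>i = 1..n. Determinant.det (step_cov (gauss_kernel sf2 L2) s2 \<tau> i (\<tau> i)))
      \<le> (sf2 ^ m * (B1 + B2)) * ln (real n) ^ (CARD('d) + 1)" if n: "n \<ge> 3" for n
  proof -
    \<comment> \<open>This q balances the two terms: the feature count q^d is at most (2 ln n)^d,
      and exp(-2 q) is at most n^-2.\<close>
    define q where "q = nat \<lceil>ln (real n)\<rceil>"
    let ?L = "ln (real n)"
    \<comment> \<open>Since e <= 3, ln n is at least 1; constants can then be absorbed into powers
      of ln n, and rounding up at most doubles it.\<close>
    have L1: "1 \<le> ?L"
    proof -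
      have "exp 1 \<le> real n" using exp_le n by linarith
      then show ?thesis using n by (subst ln_ge_iff) auto
    qed
    have q1: "?L \<le> real q" unfolding q_def by linarith
    have q2: "real q \<le> 2 * ?L" unfolding q_def using L1 by linarith
    have ln_le: "ln (1 + real n * A) \<le> (1 + ln (1 + A)) * ?L"
    proof -
      have "1 + real n * A \<le> real n * (1 + A)" using n A by (simp add: distrib_left)
      then have "ln (1 + real n * A) \<le> ln (real n * (1 + A))"
        using n A by (intro ln_mono) (auto intro: add_pos_nonneg)
      also have "\<dots> = ?L + ln (1 + A)" using n A by (subst ln_mult) auto
      also have "\<dots> \<le> ?L + ln (1 + A) * ?L" using L1 A by simp
      finally show ?thesis by (simp add: algebra_simps)
    qed
    have eq: "real (n * Suc m) * sf2 / s2 = real n * A"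
      unfolding A_def of_nat_mult by simp
    have "(s2 + sf2) * (real (q ^ CARD('d)) * ln (1 + real n * A))
        \<le> (s2 + sf2) * ((2 * ?L) ^ CARD('d) * ((1 + ln (1 + A)) * ?L))"
    proof (intro mult_left_mono mult_mono)
      show "real (q ^ CARD('d)) \<le> (2 * ?L) ^ CARD('d)" using q2 unfolding of_nat_power by (intro power_mono) auto
      show "0 \<le> ln (1 + real n * A)" using A by simp
    qed (use ln_le s2 sf2 L1 in auto)
    also have "\<dots> = B1 * ?L ^ (CARD('d) + 1)" by (simp add: B1_def power_mult_distrib)
    finally have 1: "(s2 + sf2) * (real (q ^ CARD('d)) * ln (1 + real n * A)) \<le> B1 * ?L ^ (CARD('d) + 1)" .
    \<comment> \<open>The approximation error grows quadratically in n apart from exp(-2 q), so the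
      whole term stays bounded by a constant.\<close>
    have "real (n * Suc m) * (2 * (C * exp (- 2 * real q)) * (1 + real n * A))
        \<le> real (n * Suc m) * (2 * (C * (1 / (real n)\<^sup>2)) * (real n * (1 + A)))"
    proof (intro mult_left_mono mult_mono)
      have "exp (- 2 * real q) \<le> exp (- (2 * ?L))" using q1 by simp
      also have "\<dots> = 1 / (real n)\<^sup>2"
        using n by (simp add: exp_minus exp_double inverse_eq_divide)
      finally show "exp (- 2 * real q) \<le> 1 / (real n)\<^sup>2" .
      show "1 + real n * A \<le> real n * (1 + A)" using n A by (simp add: distrib_left)
    qed (use C0 A in auto)
    also have "\<dots> = B2" using n unfolding B2_def of_nat_mult by (simp add: power2_eq_square)
    also have "\<dots> \<le> B2 * ?L ^ (CARD('d) + 1)"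
      using L1 C0 A mult_left_mono[of 1 "?L ^ (CARD('d) + 1)" B2] by (simp add: B2_def one_le_power del: power_Suc)
    finally have 2: "real (n * Suc m) * (2 * (C * exp (- 2 * real q)) * (1 + real n * A))
        \<le> B2 * ?L ^ (CARD('d) + 1)" .
    have "(\<Sum>i = 1..n. Determinant.det (step_cov (gauss_kernel sf2 L2) s2 \<tau> i (\<tau> i)))
      \<le> sf2 ^ m * ((s2 + sf2) * (real (q ^ CARD('d)) * ln (1 + real n * A))
        + real (n * Suc m) * (2 * (C * exp (- 2 * real q)) * (1 + real n * A)))"
      by (rule C[rule_format, of n q, unfolded eq])
    also have "\<dots> \<le> sf2 ^ m * (B1 * ?L ^ (CARD('d) + 1) + B2 * ?L ^ (CARD('d) + 1))"
      using 1 2 sf2 by (intro mult_left_mono add_mono) auto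
    finally show ?thesis by (simp add: algebra_simps)
  qed
  then show ?thesis by blast
qed

theorem theorem2:
  fixes X :: "(real^'d) set"
    and m :: nat
    and sf2 s2 :: real
    and L2 :: "real^'d^'d"
    and k :: "real^'d \<Rightarrow> real^'d \<Rightarrow> real"
    and P :: "'p set"
    and \<phi> :: "real^'d \<Rightarrow> (real^'d) list list \<Rightarrow> 'p \<Rightarrow> (real^'d) list"
    and x0 :: "real^'d"
    and \<tau> \<tau>' :: "nat \<Rightarrow> (real^'d) list"
    and \<eta> \<eta>' :: "nat \<Rightarrow> 'p"
  assumes "compact X" and "convex X"
    and "m \<ge> 1"
    and "sf2 > 0" and "sym_pos_def L2" and "s2 > 0"
    and "k = gauss_kernel sf2 L2"
    and "\<forall>x\<in>X. \<forall>x'\<in>X. k x x' \<le> 1"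
    and "\<forall>i\<ge>1. \<forall>p\<in>P. length (candidate \<phi> x0 \<tau> i p) = m \<and> set (candidate \<phi> x0 \<tau> i p) \<subseteq> X"
    and "\<forall>i\<ge>1. \<tau> i = candidate \<phi> x0 \<tau> i (\<eta> i)"
    and "\<forall>i\<ge>1. is_arg_max (\<lambda>p. Determinant.det (step_cov k s2 \<tau> i (candidate \<phi> x0 \<tau> i p)))
                 (\<lambda>p. p \<in> P) (\<eta> i)"
    and "\<forall>i\<ge>1. \<eta>' i \<in> P \<and> \<tau>' i = candidate \<phi> x0 \<tau> i (\<eta>' i)"
  shows "(\<lambda>n. (1 / real n) * (\<Sum>i = 1..n. Determinant.det (step_cov k s2 \<tau> i (\<tau>' i))))
           \<in> O(\<lambda>n. ln (real n) ^ (CARD('d) + 1) / real n)"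
proof -
  \<comment> \<open>Splits a trajectory into its first point and the m' remaining ones.\<close>
  obtain m' where m: "m = Suc m'" using assms(3) by (cases m) auto
  let ?det = "\<lambda>i t. Determinant.det (step_cov k s2 \<tau> i t)"
  have \<eta>P: "\<eta> i \<in> P" if "i \<ge> 1" for i
    using assms(11) that by (simp add: is_arg_max_def)
  have \<tau>: "length (\<tau> i) = Suc m'" "set (\<tau> i) \<subseteq> X" if "i \<ge> 1" for i
    using assms(9) \<eta>P[OF that] that unfolding m by (simp_all add: assms(10)[rule_format, OF that])
  then have all: "\<forall>i\<ge>1. length (\<tau> i) = Suc m'" "\<forall>i\<ge>1. set (\<tau> i) \<subseteq> X" by blast+
  have \<tau>': "length (\<tau>' i) = Suc m'" "set (\<tau>' i) \<subseteq> X" if "i \<ge> 1" for i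
    using assms(9,12) that unfolding m by simp_all
  \<comment> \<open>Both determinants are conditioned on the history of \<tau>, and the competitor
    is a candidate of the same step, so maximality compares them directly.\<close>
  have le: "?det i (\<tau>' i) \<le> ?det i (\<tau> i)" if "i \<ge> 1" for i
  proof -
    have "\<not> ?det i (\<tau>' i) > ?det i (candidate \<phi> x0 \<tau> i (\<eta> i))"
      using assms(11,12) that by (auto simp: is_arg_max_def)
    then show ?thesis using assms(10) that by (metis not_less)
  qed
  \<comment> \<open>The asymptotic statement concerns absolute values, so an upper bound on the sum
    alone would not suffice.\<close>
  have nonneg: "0 \<le> ?det i (\<tau>' i)" if "i \<ge> 1" for i
  proof -
    have "set (concat (executed \<tau> i)) \<subseteq> X" using \<tau>(2) by (fastforce simp: executed_def)
    then show ?thesis unfolding step_cov_def assms(7)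
      by (rule det_pred_cov_bounds(1)[OF psd_kernel_on_gauss[OF assms(1,4,5)] assms(6), where v = sf2 and m = m'])
        (use \<tau>' that in \<open>auto simp: gauss_kernel_def\<close>)
  qed
  obtain B where B: "\<forall>n\<ge>3. (\<Sum>i = 1..n. ?det i (\<tau> i)) \<le> B * ln (real n) ^ (CARD('d) + 1)"
    using sum_det_gauss_bigo[OF assms(1,4,5,6) all] unfolding assms(7) by (elim exE)
  show ?thesis
  proof (rule bigoI)
    show "\<forall>\<^sub>F n in sequentially. norm ((1 / real n) * (\<Sum>i = 1..n. ?det i (\<tau>' i)))
        \<le> B * norm (ln (real n) ^ (CARD('d) + 1) / real n)"
      using eventually_ge_at_top[of 3]
    proof eventually_elim
      case (elim n)
      have "(\<Sum>i = 1..n. ?det i (\<tau>' i)) \<le> (\<Sum>i = 1..n. ?det i (\<tau> i))"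
        using le by (intro sum_mono) auto
      also have "\<dots> \<le> B * ln (real n) ^ (CARD('d) + 1)" using B elim by blast
      finally have "(1 / real n) * (\<Sum>i = 1..n. ?det i (\<tau>' i)) \<le> (1 / real n) * (B * ln (real n) ^ (CARD('d) + 1))"
        by (intro mult_left_mono) auto
      moreover have "0 \<le> (\<Sum>i = 1..n. ?det i (\<tau>' i))" using nonneg by (intro sum_nonneg) auto
      moreover have "0 \<le> ln (real n)" using elim by simp
      ultimately show ?case by simp
    qed
  qed
qed

end
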